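(* Fix a 2-dimensional linear subspace $L\subset\mathbb{R}^d$. As $t\to\infty$ and $\delta_t\to 0$, $$\mathbb{E}_V\,\overline{\mathrm{cr}}(G_L)=\tfrac18\,c_d\,t^4\delta_t^{2d+2}\,I^{(2)}(W,L)+o\bigl(t^4\delta_t^{2d+2}\bigr).$$
   Context: Setup. Let $d\ge 2$ and let $W\subset\mathbb{R}^d$ be a compact convex set with $\mathrm{vol}_d(W)=1$. For $t>0$, $V$ is a Poisson point process of intensity $t$ on $W$ (equivalently: draw $N\sim\mathrm{Poisson}(t)$ and then $N$ i.i.d. uniform points in $W$). $(\delta_t)_{t>0}$ is a family of positive reals. The random geometric graph $G$ has vertex set $V$ and a straight-segment edge between distinct $u,v\in V$ iff $\|u-v\|\le\delta_t$. For a 2-dimensional linear subspace $L$, $x|_L$ is the orthogonal projection of a point or set onto $L$, $L^\perp$ the $(d-2)$-dimensional orthogonal complement, and $G_L$ the straight-line drawing of $G$ projected onto $L$. With $[u,v]$ the segment between $u,v$ and $V^4_{\neq}$ the ordered 4-tuples of pairwise distinct points of $V$, the rectilinear crossing number of $G_L$ is $$\overline{\mathrm{cr}}(G_L)=\tfrac18\sum_{(v_1,\dots,v_4)\in V^4_{\neq}}\mathbf 1\bigl([v_1,v_2]|_L\cap[v_3,v_4]|_L\neq\emptyset\bigr)\mathbf 1(\|v_1-v_2\|\le\delta_t)\mathbf 1(\|v_3-v_4\|\le\delta_t).$$ $B_d$ is the unit ball of $\mathbb{R}^d$, $\kappa_d=\mathrm{vol}_d(B_d)$, and $2B_2$ the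 disc of radius $2$ centered at $0$ in $L$. The constant $$c_d=\int_{B_d\times 2B_2\times B_d}\mathbf 1\bigl([0,x|_L]\cap(y+[0,z|_L])\neq\emptyset\bigr)\,dz\,dy\,dx$$ (with $y$ integrated w.r.t. 2-dimensional Lebesgue measure on $L$) does not depend on $L$. For $k\ge1$, $I^{(k)}(W,L)=\int_{W|_L}\mathrm{vol}_{d-2}\bigl((u+L^\perp)\cap W\bigr)^k\,du$ (2-dimensional Lebesgue measure on $L$). $\mathbb{E}_V,\mathrm{Var}_V$ denote expectation/variance with respect to $V$. *)

theory Defs
  imports "HOL-Probability.Probability"
begin

definition oproj :: "'a::euclidean_space set \<Rightarrow> 'a \<Rightarrow> 'a" where
  "oproj L x = (THE y. y \<in> L \<and> (\<forall>z\<in>L. (x - y) \<bullet> z = 0))"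

definition ocompl :: "'a::euclidean_space set \<Rightarrow> 'a set" where
  "ocompl L = {x. \<forall>z\<in>L. x \<bullet> z = 0}"

definition onb :: "'a::euclidean_space set \<Rightarrow> nat \<Rightarrow> 'a" where
  "onb M = (SOME b. (\<forall>i<dim M. b i \<in> M) \<and>
                    (\<forall>i<dim M. \<forall>j<dim M. b i \<bullet> b j = (if i = j then 1 else 0)))"

definition flat_param :: "'a::euclidean_space set \<Rightarrow> 'a \<Rightarrow> (nat \<Rightarrow> real) \<Rightarrow> 'a" where
  "flat_param M u c = u + (\<Sum>i<dim M. c i *\<^sub>R onb M i)"

definition flat_lborel :: "'a::euclidean_space set \<Rightarrow> (nat \<Rightarrow> real) measure" where
  "flat_lborel M = PiM {..<dim M} (\<lambda>_. lborel)"

definition flat_vol :: "'a::euclidean_space set \<Rightarrow> 'a \<Rightarrow> 'a set \<Rightarrow> real" where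
  "flat_vol M u S = measure (flat_lborel M) (flat_param M u -` S \<inter> space (flat_lborel M))"

definition sub_integral :: "'a::euclidean_space set \<Rightarrow> ('a \<Rightarrow> real) \<Rightarrow> real" where
  "sub_integral M f = (\<integral>c. f (flat_param M 0 c) \<partial>flat_lborel M)"

definition cd_const :: "'a::euclidean_space set \<Rightarrow> real" where
  "cd_const L =
     (\<integral>x. indicator (cball 0 1) x *
        sub_integral L (\<lambda>y. indicator (cball 0 2) y *
          (\<integral>z. indicator (cball 0 1) z *
               (if oproj L ` closed_segment 0 x \<inter> ((\<lambda>w. y + w) ` oproj L ` closed_segment 0 z) \<noteq> {}
                then 1 else 0) \<partial>lborel)) \<partial>lborel)"

definition Ik :: "nat \<Rightarrow> 'a::euclidean_space set \<Rightarrow> 'a set \<Rightarrow> real" where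
  "Ik k W L = sub_integral L (\<lambda>u. indicator (oproj L ` W) u * flat_vol (ocompl L) u W ^ k)"

text \<open>Rectilinear crossing number of the projected drawing G_L of the geometric graph
  with vertex set V and connection radius \<delta>.\<close>
definition rect_cr :: "'a::euclidean_space set \<Rightarrow> real \<Rightarrow> 'a set \<Rightarrow> real" where
  "rect_cr L \<delta> V = 1/8 *
     (\<Sum>(v1,v2,v3,v4) \<in> {(v1,v2,v3,v4). v1 \<in> V \<and> v2 \<in> V \<and> v3 \<in> V \<and> v4 \<in> V \<and> distinct [v1,v2,v3,v4]}.
        (if oproj L ` closed_segment v1 v2 \<inter> oproj L ` closed_segment v3 v4 \<noteq> {} then 1 else 0) *
        (if norm (v1 - v2) \<le> \<delta> then 1 else 0) * (if norm (v3 - v4) \<le> \<delta> then 1 else 0))"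

text \<open>Expectation of F(V) for V a Poisson process of intensity t on W (vol W = 1):
  N ~ Poisson(t), then N i.i.d. uniform points in W.\<close>
definition poisson_exp :: "real \<Rightarrow> 'a::euclidean_space set \<Rightarrow> ('a set \<Rightarrow> real) \<Rightarrow> real" where
  "poisson_exp t W F =
     (\<Sum>n. t ^ n / fact n * exp (- t) *
        (\<integral>p. F (p ` {..<n}) \<partial>PiM {..<n} (\<lambda>_. uniform_measure lborel W)))"

end

theory Submission
  imports Defs
begin

text \<open>
  Since the fourth factorial moment of a Poisson variable is \<open>t ^ 4\<close>, conditioning on the number
  of points turns the expectation into \<open>t ^ 4 / 8\<close> times an integral over \<open>W ^ 4\<close>.
  Write the first edge as \<open>u + w\<close>, \<open>u + w + \<delta> x\<close> and the second one as \<open>u + \<delta> y + w'\<close>,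
  \<open>u + \<delta> y + w' + \<delta> z\<close> with \<open>u, y \<in> L\<close> and \<open>w, w'\<close> orthogonal to \<open>L\<close>. This extracts the
  factor \<open>\<delta> ^ (2 d + 2)\<close>, and the crossing condition only involves \<open>x, y, z\<close>. As \<open>\<delta>\<close> tends to
  \<open>0\<close>, the constraints that the four endpoints lie in \<open>W\<close> become \<open>u + w \<in> W\<close> and \<open>u + w' \<in> W\<close>
  off the null set where one of these points is on the frontier of the convex set \<open>W\<close>; by
  dominated convergence the integral tends to the product of \<open>c_d\<close> and the integral of the
  squared section volumes.
\<close>

subsection \<open>Orthonormal coordinates\<close>

text \<open>For each \<open>t > 0\<close> the expectation is exactly
  \<open>1/8 * t ^ 4 * r ^ (2 * DIM('a) + dim L)\<close> times an integral that depends on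
  \<open>t\<close> only through \<open>r = \<delta> t\<close>; all of the asymptotics is the
  continuity of that integral at \<open>r = 0\<close>. The main obstacle is the choice of measures.
  The constants are integrals over orthonormal coordinates of \<open>L\<close> and of its
  complement, while the points follow Lebesgue measure on the whole space. Matching them takes
  Fubini's theorem for an arbitrary orthogonal splitting, which the product structure along the
  standard basis does not give directly. Substitutions and exchanges of integrals are done with
  values in \<open>ennreal\<close>; the Bochner integrals of the definitions are reached through
  \<open>enn2real\<close>.\<close>

lemma onb_exists:
  fixes M :: "'a::euclidean_space set"
  assumes "subspace M"
  shows "\<exists>b. (\<forall>i<dim M. b i \<in> M) \<and>
             (\<forall>i<dim M. \<forall>j<dim M. b i \<bullet> b j = (if i = j then 1 else 0))"
proof -
  obtain B where B: "B \<subseteq> M" "pairwise orthogonal B" "\<And>x. x \<in> B \<Longrightarrow> norm x = 1"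
      "independent B" "card B = dim M" "span B = M"
    using orthonormal_basis_subspace[OF assms] by blast
  from B(4) have "finite B" by (rule independent_imp_finite)
  then obtain b where b: "bij_betw b {..<dim M} B"
    using ex_bij_betw_nat_finite[of B] B(5) by (auto simp: lessThan_atLeast0)
  have mem: "b i \<in> B" if "i < dim M" for i
    using b that by (auto simp: bij_betw_def)
  have "b i \<bullet> b j = (if i = j then 1 else 0)" if "i < dim M" "j < dim M" for i j
  proof (cases "i = j")
    case True
    then show ?thesis using B(3)[OF mem[OF that(1)]] by (simp add: dot_square_norm)
  next
    case False
    then have "b i \<noteq> b j" using b that by (auto simp: bij_betw_def inj_on_def)
    then show ?thesis using B(2) mem[OF that(1)] mem[OF that(2)] False
      by (auto simp: pairwise_def orthogonal_def)
  qed
  then show ?thesis using mem B(1) by blast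
qed

lemma
  assumes "subspace M"
  shows onb_in: "i < dim M \<Longrightarrow> onb M i \<in> M"
    and onb_inner: "i < dim M \<Longrightarrow> j < dim M \<Longrightarrow> onb M i \<bullet> onb M j = (if i = j then 1 else 0)"
  using someI_ex[OF onb_exists[OF assms]] unfolding onb_def by blast+

text \<open>The \<open>dim M\<close> orthonormal vectors are independent, so by counting they span
  \<open>M\<close>. The residual lies in their span and is orthogonal to each of them, hence to
  itself.\<close>

lemma onb_expansion:
  assumes M: "subspace M" and x: "x \<in> M"
  shows "(\<Sum>i<dim M. (x \<bullet> onb M i) *\<^sub>R onb M i) = x"
proof -
  let ?B = "onb M ` {..<dim M}"
  have inj: "inj_on (onb M) {..<dim M}"
    using onb_inner[OF M] by (intro inj_onI) (metis lessThan_iff zero_neq_one)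
  have "pairwise orthogonal ?B" "0 \<notin> ?B"
    using onb_inner[OF M] by (auto simp: pairwise_def orthogonal_def) (metis inner_zero_left zero_neq_one)
  then have "independent ?B" by (rule pairwise_orthogonal_independent)
  moreover have "?B \<subseteq> M" using onb_in[OF M] by auto
  ultimately have span: "M \<subseteq> span ?B"
    by (intro card_ge_dim_independent) (auto simp: card_image[OF inj])
  define y where "y = (\<Sum>i<dim M. (x \<bullet> onb M i) *\<^sub>R onb M i)"
  have "orthogonal (x - y) b" if "b \<in> ?B" for b
  proof -
    from that obtain j where j: "j < dim M" "b = onb M j" by auto
    have "y \<bullet> b = (\<Sum>i<dim M. if i = j then x \<bullet> onb M i else 0)"
      unfolding y_def j inner_sum_left by (intro sum.cong) (auto simp: onb_inner[OF M _ j(1)])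
    also have "\<dots> = x \<bullet> b" using j by simp
    finally show ?thesis by (simp add: orthogonal_def inner_diff_left)
  qed
  moreover have "x - y \<in> span ?B"
    unfolding y_def using subsetD[OF span x]
    by (intro span_diff span_sum span_scale) (auto intro: span_base)
  ultimately have "orthogonal (x - y) (x - y)"
    by (metis orthogonal_to_span)
  then show ?thesis by (simp add: y_def orthogonal_def)
qed

lemma flat_param_shift: "flat_param M u c = u + flat_param M 0 c"
  by (simp add: flat_param_def)

lemma flat_param_in: "subspace M \<Longrightarrow> flat_param M 0 c \<in> M"
  by (auto simp: flat_param_def intro!: subspace_sum subspace_scale onb_in)

text \<open>The restriction to \<open>{..<dim M}\<close> is there because the points of a product
  measure space are extensional functions; this is the substitution of
  \<open>nn_integral_PiM_lborel_affine\<close>.\<close>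

lemma flat_param_affine:
  "flat_param M 0 (\<lambda>i\<in>{..<dim M}. t i + r * c i) = flat_param M 0 t + r *\<^sub>R flat_param M 0 c"
  by (simp add: flat_param_def scaleR_sum_right scaleR_add_left sum.distrib)

lemma flat_param_inner_onb:
  assumes M: "subspace M" and j: "j < dim M"
  shows "flat_param M 0 c \<bullet> onb M j = c j"
proof -
  have "flat_param M 0 c \<bullet> onb M j = (\<Sum>i<dim M. if i = j then c i else 0)"
    unfolding flat_param_def inner_sum_left add_0_left
    by (intro sum.cong) (auto simp: onb_inner[OF M _ j])
  then show ?thesis using j by simp
qed

lemma flat_param_norm:
  assumes M: "subspace M"
  shows "(norm (flat_param M 0 c))\<^sup>2 = (\<Sum>i<dim M. (c i)\<^sup>2)"
proof -
  have "(norm (flat_param M 0 c))\<^sup>2 = (\<Sum>i<dim M. c i * (flat_param M 0 c \<bullet> onb M i))"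
    unfolding power2_norm_eq_inner
    by (subst (2) flat_param_def) (simp add: inner_sum_right)
  then show ?thesis by (simp add: flat_param_inner_onb[OF M] power2_eq_square)
qed

lemma flat_param_surj:
  assumes "subspace M" "x \<in> M"
  shows "flat_param M 0 (\<lambda>i. x \<bullet> onb M i) = x"
  using onb_expansion[OF assms] by (simp add: flat_param_def)

lemma measurable_flat_param [measurable]:
  "flat_param M u \<in> borel_measurable (flat_lborel M)"
  unfolding flat_param_def[abs_def] flat_lborel_def by measurable

section \<open>Orthogonal complement and orthogonal projection\<close>

lemma subspace_ocompl [simp]: "subspace (ocompl L)"
  by (auto simp: ocompl_def subspace_def inner_left_distrib)

lemma ocompl_inner: "w \<in> ocompl L \<Longrightarrow> u \<in> L \<Longrightarrow> w \<bullet> u = 0"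
  by (simp add: ocompl_def)

lemma dim_ocompl:
  fixes L :: "'a::euclidean_space set"
  assumes "subspace L"
  shows "dim (ocompl L) + dim L = DIM('a)"
proof -
  have "ocompl L = {y \<in> UNIV. \<forall>x\<in>L. orthogonal x y}"
    by (auto simp: ocompl_def orthogonal_def inner_commute)
  then show ?thesis using dim_subspace_orthogonal_to_vectors[OF assms, of UNIV] by simp
qed

text \<open>Turns the definite description into a test: exhibit a candidate. Two candidates differ
  by a vector of \<open>L\<close> that is orthogonal to \<open>L\<close>, hence to itself.\<close>

lemma oproj_unique:
  assumes L: "subspace L" and y: "y \<in> L" "x - y \<in> ocompl L"
  shows "oproj L x = y"
  unfolding oproj_def
proof (rule the_equality)
  show "y \<in> L \<and> (\<forall>z\<in>L. (x - y) \<bullet> z = 0)" using y by (auto simp: ocompl_def)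
next
  fix y' assume y': "y' \<in> L \<and> (\<forall>z\<in>L. (x - y') \<bullet> z = 0)"
  then have "y - y' \<in> L" using y L by (simp add: subspace_diff)
  then have "(x - y') \<bullet> (y - y') = 0" "(x - y) \<bullet> (y - y') = 0"
    using y' y by (auto simp: ocompl_def)
  then have "(y - y') \<bullet> (y - y') = 0" by (simp add: inner_diff_left)
  then show "y' = y" by simp
qed

lemma diff_flat_param_in:
  assumes L: "subspace L"
  shows "x - flat_param L 0 (\<lambda>i. x \<bullet> onb L i) \<in> ocompl L"
proof -
  let ?y = "flat_param L 0 (\<lambda>i. x \<bullet> onb L i)"
  have "(x - ?y) \<bullet> z = 0" if z: "z \<in> L" for z
  proof -
    have "(x - ?y) \<bullet> flat_param L 0 (\<lambda>i. z \<bullet> onb L i)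
        = (\<Sum>i<dim L. (z \<bullet> onb L i) * ((x - ?y) \<bullet> onb L i))"
      by (subst (2) flat_param_def) (simp add: inner_sum_right)
    also have "\<dots> = 0"
      by (intro sum.neutral) (simp add: inner_diff_left flat_param_inner_onb[OF L])
    finally show ?thesis using flat_param_surj[OF L z] by simp
  qed
  then show ?thesis by (simp add: ocompl_def)
qed

lemma oproj_eq: "subspace L \<Longrightarrow> oproj L x = flat_param L 0 (\<lambda>i. x \<bullet> onb L i)"
  by (intro oproj_unique flat_param_in diff_flat_param_in)

lemma linear_oproj: "subspace L \<Longrightarrow> linear (oproj L)"
  by (simp add: linear_iff oproj_eq flat_param_def inner_left_distrib scaleR_add_left
      sum.distrib scaleR_sum_right)

lemma oproj_in: "subspace L \<Longrightarrow> oproj L x \<in> L"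
  by (simp add: oproj_eq flat_param_in)

lemma diff_oproj_in: "subspace L \<Longrightarrow> x - oproj L x \<in> ocompl L"
  by (simp add: oproj_eq diff_flat_param_in)

lemma norm_oproj_decomp:
  assumes L: "subspace L"
  shows "(norm (oproj L x))\<^sup>2 + (norm (x - oproj L x))\<^sup>2 = (norm x)\<^sup>2"
proof -
  have "orthogonal (oproj L x) (x - oproj L x)"
    using ocompl_inner[OF diff_oproj_in[OF L] oproj_in[OF L]]
    by (simp add: orthogonal_def inner_commute)
  from norm_add_Pythagorean[OF this] show ?thesis by simp
qed

lemma norm_oproj_le: "subspace L \<Longrightarrow> norm (oproj L x) \<le> norm x"
  using norm_oproj_decomp[of L x] zero_le_power2[of "norm (oproj L x)"]
    zero_le_power2[of "norm (x - oproj L x)"] by (intro power2_le_imp_le[OF _ norm_ge_zero]) linarith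

lemma norm_diff_oproj_le: "subspace L \<Longrightarrow> norm (x - oproj L x) \<le> norm x"
  using norm_oproj_decomp[of L x] zero_le_power2[of "norm (oproj L x)"]
    zero_le_power2[of "norm (x - oproj L x)"] by (intro power2_le_imp_le[OF _ norm_ge_zero]) linarith

subsection \<open>Affine changes of variables in coordinates\<close>

text \<open>A product measure is determined by its values on boxes. On a box, the weighted image
  measure factors into the one-dimensional scaling law of Lebesgue measure.\<close>

lemma nn_integral_PiM_lborel_affine:
  fixes f :: "('i \<Rightarrow> real) \<Rightarrow> ennreal"
  assumes I: "finite I" and r: "r > 0" and f [measurable]: "f \<in> borel_measurable (\<Pi>\<^sub>M i\<in>I. lborel)"
  shows "(\<integral>\<^sup>+c. f c \<partial>(\<Pi>\<^sub>M i\<in>I. lborel))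
       = ennreal (r ^ card I) * (\<integral>\<^sup>+c. f (\<lambda>i\<in>I. t i + r * c i) \<partial>(\<Pi>\<^sub>M i\<in>I. lborel))"
proof -
  interpret product_sigma_finite "\<lambda>_::'i. lborel :: real measure"
    by unfold_locales
  let ?P = "\<Pi>\<^sub>M i\<in>I. (lborel :: real measure)"
  let ?T = "\<lambda>c. \<lambda>i\<in>I. t i + r * c i"
  have T [measurable]: "?T \<in> measurable ?P ?P" by measurable
  have "density (distr ?P ?P ?T) (\<lambda>_. ennreal (r ^ card I)) = ?P" (is "?D = _")
  proof (rule PiM_eqI[OF I])
    fix A assume A: "\<And>i. i \<in> I \<Longrightarrow> A i \<in> sets (lborel :: real measure)"
    have meas: "Pi\<^sub>E I A \<in> sets ?P" using A I by (intro sets_PiM_I_finite) auto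
    have vim: "?T -` Pi\<^sub>E I A \<inter> space ?P = Pi\<^sub>E I (\<lambda>i. (\<lambda>x. t i + r * x) -` A i)"
      by (auto simp: space_PiM PiE_iff)
    have "emeasure ?D (Pi\<^sub>E I A) = ennreal (r ^ card I) * emeasure ?P (?T -` Pi\<^sub>E I A \<inter> space ?P)"
      using meas by (simp add: emeasure_density_const emeasure_distr)
    also have "\<dots> = ennreal (r ^ card I) * (\<Prod>i\<in>I. emeasure lborel ((\<lambda>x. t i + r * x) -` A i))"
    proof -
      have "(\<lambda>x. t i + r * x) -` A i \<in> sets lborel" if "i \<in> I" for i
        using measurable_sets[of "\<lambda>x. t i + r * x" lborel lborel "A i"] A[OF that] by simp
      then show ?thesis unfolding vim by (subst emeasure_PiM[OF I]) auto
    qed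
    also have "\<dots> = (\<Prod>i\<in>I. ennreal r * emeasure lborel ((\<lambda>x. t i + r * x) -` A i))"
      using r by (simp add: prod.distrib ennreal_power)
    also have "\<dots> = (\<Prod>i\<in>I. emeasure lborel (A i))"
    proof (intro prod.cong refl)
      fix i assume i: "i \<in> I"
      have "emeasure lborel (A i)
          = emeasure (density (distr lborel borel (\<lambda>x. t i + r * x)) (\<lambda>_. ennreal \<bar>r\<bar>)) (A i)"
        using r by (subst lborel_real_affine[of r "t i"]) simp_all
      also have "\<dots> = ennreal r * emeasure lborel ((\<lambda>x. t i + r * x) -` A i)"
        using A[OF i] r by (simp add: emeasure_density_const emeasure_distr)
      finally show "ennreal r * emeasure lborel ((\<lambda>x. t i + r * x) -` A i) = emeasure lborel (A i)" ..
    qed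
    finally show "emeasure ?D (Pi\<^sub>E I A) = (\<Prod>i\<in>I. emeasure lborel (A i))" .
  qed simp
  then have "(\<integral>\<^sup>+c. f c \<partial>?P) = (\<integral>\<^sup>+c. f c \<partial>?D)" by (simp only:)
  also have "\<dots> = ennreal (r ^ card I) * (\<integral>\<^sup>+c. f (?T c) \<partial>?P)"
    by (simp add: nn_integral_density nn_integral_cmult nn_integral_distr)
  finally show ?thesis .
qed

lemma sigma_finite_flat_lborel: "sigma_finite_measure (flat_lborel M)"
proof -
  interpret product_sigma_finite "\<lambda>_::nat. lborel :: real measure"
    by unfold_locales
  show ?thesis unfolding flat_lborel_def by (rule sigma_finite) simp
qed

text \<open>Serves twice: with \<open>r = 1\<close> as translation invariance in the Haar argument,
  and with the edge length as \<open>r\<close> to rescale the offset between two edges inside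
  \<open>L\<close>. The shift lies in \<open>M\<close> so that it can be expressed in
  coordinates.\<close>

lemma nn_integral_flat_affine:
  fixes f :: "'a::euclidean_space \<Rightarrow> ennreal"
  assumes r: "r > 0" and f [measurable]: "f \<in> borel_measurable borel"
    and M: "subspace M" and u: "u \<in> M"
  shows "(\<integral>\<^sup>+c. f (flat_param M 0 c) \<partial>flat_lborel M)
       = ennreal (r ^ dim M) * (\<integral>\<^sup>+c. f (u + r *\<^sub>R flat_param M 0 c) \<partial>flat_lborel M)"
proof -
  have *: "(\<lambda>c. f (flat_param M 0 c)) \<in> borel_measurable (\<Pi>\<^sub>M i\<in>{..<dim M}. lborel)"
    using measurable_compose[OF measurable_flat_param f] by (simp add: flat_lborel_def)
  have "(\<integral>\<^sup>+c. f (flat_param M 0 c) \<partial>flat_lborel M) = ennreal (r ^ dim M) *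
      (\<integral>\<^sup>+c. f (flat_param M 0 (\<lambda>i\<in>{..<dim M}. u \<bullet> onb M i + r * c i)) \<partial>flat_lborel M)"
    unfolding flat_lborel_def
    using nn_integral_PiM_lborel_affine[OF _ r *, of "\<lambda>i. u \<bullet> onb M i"] by simp
  then show ?thesis
    by (simp add: flat_param_affine flat_param_surj[OF M u])
qed

subsection \<open>Lebesgue measure in orthonormal coordinates\<close>

text \<open>The product depends on the coordinates only through the sum of their squares. By
  Parseval the same function of the norm is therefore a probability density both on the whole space
  and in orthonormal coordinates of any subspace, which makes it a convenient test function.\<close>

lemma prod_std_normal_density:
  assumes "finite I"
  shows "(\<Prod>i\<in>I. std_normal_density (c i))
       = (1 / sqrt (2 * pi)) ^ card I * exp (- (\<Sum>i\<in>I. (c i)\<^sup>2) / 2)"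
proof -
  have "(\<Prod>i\<in>I. std_normal_density (c i)) = (\<Prod>i\<in>I. (1 / sqrt (2 * pi)) * exp (- (c i)\<^sup>2 / 2))"
    by (simp add: std_normal_density_def)
  also have "\<dots> = (1 / sqrt (2 * pi)) ^ card I * exp (\<Sum>i\<in>I. - (c i)\<^sup>2 / 2)"
    unfolding prod.distrib prod_constant exp_sum[OF assms] ..
  also have "(\<Sum>i\<in>I. - (c i)\<^sup>2 / 2) = - (\<Sum>i\<in>I. (c i)\<^sup>2) / 2"
    by (simp add: sum_divide_distrib sum_negf)
  finally show ?thesis .
qed

lemma nn_integral_std_normal_density:
  "(\<integral>\<^sup>+x. ennreal (std_normal_density x) \<partial>lborel) = 1"
proof -
  interpret prob_space "density lborel (\<lambda>x. ennreal (std_normal_density x))"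
    by (rule prob_space_normal_density) simp
  show ?thesis using emeasure_space_1 by (simp add: emeasure_density)
qed

lemma nn_integral_gaussian_lborel:
  "(\<integral>\<^sup>+x.
      ennreal ((1 / sqrt (2 * pi)) ^ DIM('a) * exp (- (norm x)\<^sup>2 / 2)) \<partial>(lborel :: 'a::euclidean_space measure)) = 1"
proof -
  have "(norm x)\<^sup>2 = (\<Sum>b\<in>Basis. (x \<bullet> b)\<^sup>2)" for x :: 'a
    unfolding power2_norm_eq_inner by (subst euclidean_inner) (simp add: power2_eq_square)
  then have "(\<integral>\<^sup>+x. ennreal ((1 / sqrt (2 * pi)) ^ DIM('a) * exp (- (norm x)\<^sup>2 / 2)) \<partial>(lborel :: 'a measure))
      = (\<integral>\<^sup>+x. (\<Prod>b\<in>Basis. ennreal (std_normal_density (x \<bullet> b))) \<partial>(lborel :: 'a measure))"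
    by (simp add: prod_ennreal prod_std_normal_density)
  also have "\<dots> = 1"
    by (subst nn_integral_lborel_prod) (simp_all add: nn_integral_std_normal_density)
  finally show ?thesis .
qed

lemma nn_integral_gaussian_flat:
  assumes "subspace M"
  shows "(\<integral>\<^sup>+c. ennreal ((1 / sqrt (2 * pi)) ^ dim M * exp (- (norm (flat_param M 0 c))\<^sup>2 / 2))
            \<partial>flat_lborel M) = 1"
proof -
  interpret product_sigma_finite "\<lambda>_::nat. lborel :: real measure"
    by unfold_locales
  have "(\<integral>\<^sup>+c. ennreal ((1 / sqrt (2 * pi)) ^ dim M * exp (- (norm (flat_param M 0 c))\<^sup>2 / 2))
            \<partial>flat_lborel M)
      = (\<integral>\<^sup>+c. (\<Prod>i<dim M. ennreal (std_normal_density (c i))) \<partial>flat_lborel M)"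
    by (simp add: prod_ennreal prod_std_normal_density flat_param_norm[OF assms])
  also have "\<dots> = 1"
    unfolding flat_lborel_def
    by (subst product_nn_integral_prod) (simp_all add: nn_integral_std_normal_density)
  finally show ?thesis .
qed

text \<open>Weil's uniqueness argument for Haar measure: the right-hand side is a translation
  invariant integral, so testing both sides against one Gaussian and swapping integrals
  shows that it is proportional to the Lebesgue integral; the Gaussian also fixes the factor.\<close>

proposition nn_integral_lborel_decomp:
  fixes f :: "'a::euclidean_space \<Rightarrow> ennreal"
  assumes L: "subspace L" and f [measurable]: "f \<in> borel_measurable borel"
  shows "(\<integral>\<^sup>+x. f x \<partial>lborel)
       = (\<integral>\<^sup>+c. \<integral>\<^sup>+d. f (flat_param L 0 c + flat_param (ocompl L) 0 d)
            \<partial>flat_lborel (ocompl L) \<partial>flat_lborel L)"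
proof -
  let ?M = "ocompl L"
  let ?P = "flat_lborel L \<Otimes>\<^sub>M flat_lborel ?M"
  interpret L: sigma_finite_measure "flat_lborel L" by (rule sigma_finite_flat_lborel)
  interpret M: sigma_finite_measure "flat_lborel ?M" by (rule sigma_finite_flat_lborel)
  interpret LM: pair_sigma_finite "flat_lborel L" "flat_lborel ?M" ..
  interpret P: sigma_finite_measure ?P by unfold_locales
  interpret XP: pair_sigma_finite "lborel :: 'a measure" ?P ..
  define \<Phi> where "\<Phi> = (\<lambda>p. flat_param L 0 (fst p) + flat_param ?M 0 (snd p))"
  have \<Phi> [measurable]: "\<Phi> \<in> borel_measurable ?P" unfolding \<Phi>_def by measurable
  have iter: "(\<integral>\<^sup>+p. h (\<Phi> p) \<partial>?P)
      = (\<integral>\<^sup>+c. \<integral>\<^sup>+d. h (flat_param L 0 c + flat_param ?M 0 d) \<partial>flat_lborel ?M \<partial>flat_lborel L)"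
    if [measurable]: "h \<in> borel_measurable borel" for h :: "'a \<Rightarrow> ennreal"
    by (subst M.nn_integral_fst[symmetric]) (simp_all add: \<Phi>_def)
  \<comment> \<open>The shift \<open>a\<close> is split along \<open>L\<close> and its complement;
    the inner integral absorbs one part and the outer integral the other.\<close>
  have inv: "(\<integral>\<^sup>+p. h (a + \<Phi> p) \<partial>?P) = (\<integral>\<^sup>+p. h (\<Phi> p) \<partial>?P)"
    if [measurable]: "h \<in> borel_measurable borel" for h :: "'a \<Rightarrow> ennreal" and a
  proof -
    define u where "u = oproj L a"
    define w where "w = a - oproj L a"
    have u: "u \<in> L" and w: "w \<in> ?M" and a: "a = u + w"
      using oproj_in[OF L] diff_oproj_in[OF L] by (auto simp: u_def w_def)
    have "(\<integral>\<^sup>+p. h (\<Phi> p) \<partial>?P)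
        = (\<integral>\<^sup>+c. \<integral>\<^sup>+d. h (flat_param L 0 c + (w + flat_param ?M 0 d))
            \<partial>flat_lborel ?M \<partial>flat_lborel L)"
      unfolding iter[OF that]
    proof (rule nn_integral_cong)
      fix c
      show "(\<integral>\<^sup>+d. h (flat_param L 0 c + flat_param ?M 0 d) \<partial>flat_lborel ?M)
          = (\<integral>\<^sup>+d. h (flat_param L 0 c + (w + flat_param ?M 0 d)) \<partial>flat_lborel ?M)"
        using nn_integral_flat_affine[where r = 1 and u = w and M = ?M and
            f = "\<lambda>x. h (flat_param L 0 c + x)"] w by simp
    qed
    also have "\<dots> = (\<integral>\<^sup>+c. \<integral>\<^sup>+d. h ((u + flat_param L 0 c) + (w + flat_param ?M 0 d))
            \<partial>flat_lborel ?M \<partial>flat_lborel L)"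
      using nn_integral_flat_affine[where r = 1 and u = u and M = L and
          f = "\<lambda>x. \<integral>\<^sup>+d. h (x + (w + flat_param ?M 0 d)) \<partial>flat_lborel ?M"] L u
      by simp
    also have "\<dots> = (\<integral>\<^sup>+p. h (a + \<Phi> p) \<partial>?P)"
      by (subst iter) (simp_all add: a ac_simps)
    finally show ?thesis ..
  qed
  define g where "g = (\<lambda>x::'a. ennreal ((1 / sqrt (2 * pi)) ^ DIM('a) * exp (- (norm x)\<^sup>2 / 2)))"
  have g [measurable]: "g \<in> borel_measurable borel" unfolding g_def by measurable
  have g_lborel: "(\<integral>\<^sup>+x. g x \<partial>lborel) = 1"
    unfolding g_def by (rule nn_integral_gaussian_lborel)
  \<comment> \<open>Evenness turns a shift of the variable \<open>x\<close> into a shift of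
    \<open>\<Phi> p\<close>, to which \<open>inv\<close> applies.\<close>
  have even: "g (x - y) = g (- x + y)" for x y
    by (simp add: g_def norm_minus_commute)
  have g_P: "(\<integral>\<^sup>+p. g (\<Phi> p) \<partial>?P) = 1"
  proof -
    define gM where "gM = (\<lambda>(N::'a set) c. ennreal ((1 / sqrt (2 * pi)) ^ dim N * exp (- (norm (flat_param N 0 c))\<^sup>2 / 2)))"
    have gM [measurable]: "gM N \<in> borel_measurable (flat_lborel N)" for N
      unfolding gM_def by measurable
    have "g (flat_param L 0 c + flat_param ?M 0 d) = gM L c * gM ?M d" for c d
    proof -
      have "orthogonal (flat_param L 0 c) (flat_param ?M 0 d)"
        using ocompl_inner[OF flat_param_in[OF subspace_ocompl] flat_param_in[OF L]]
        by (simp add: orthogonal_def inner_commute)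
      from norm_add_Pythagorean[OF this]
      show ?thesis
        unfolding g_def gM_def dim_ocompl[OF L, symmetric]
        by (simp add: ennreal_mult[symmetric] power_add exp_add[symmetric] add_divide_distrib
            diff_divide_distrib del: power_divide)
    qed
    then have "(\<integral>\<^sup>+p. g (\<Phi> p) \<partial>?P)
        = (\<integral>\<^sup>+c. gM L c * (\<integral>\<^sup>+d. gM ?M d \<partial>flat_lborel ?M) \<partial>flat_lborel L)"
      by (simp add: iter nn_integral_cmult)
    also have "\<dots> = 1"
      unfolding gM_def using L by (simp only: nn_integral_gaussian_flat subspace_ocompl mult_1_right)
    finally show ?thesis .
  qed
  \<comment> \<open>The factor inserted is the Lebesgue mass of \<open>g\<close>, which is 1.
    Between the two exchanges of integrals, invariance of Lebesgue measure moves the shift from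
    \<open>f\<close> to \<open>g\<close>; after the second one the inner integral is the mass of
    \<open>g\<close> under \<open>?P\<close>, again 1.\<close>
  have "(\<integral>\<^sup>+p. f (\<Phi> p) \<partial>?P) = (\<integral>\<^sup>+x. g x * (\<integral>\<^sup>+p. f (\<Phi> p) \<partial>?P) \<partial>lborel)"
    by (simp add: nn_integral_multc g_lborel)
  also have "\<dots> = (\<integral>\<^sup>+x. \<integral>\<^sup>+p. g x * f (x + \<Phi> p) \<partial>?P \<partial>lborel)"
    by (simp add: nn_integral_cmult inv)
  also have "\<dots> = (\<integral>\<^sup>+p. \<integral>\<^sup>+x. g x * f (x + \<Phi> p) \<partial>lborel \<partial>?P)"
    by (subst XP.Fubini') simp_all
  also have "\<dots> = (\<integral>\<^sup>+p. \<integral>\<^sup>+x. g (x - \<Phi> p) * f x \<partial>lborel \<partial>?P)"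
  proof (rule nn_integral_cong)
    fix p
    have "(\<integral>\<^sup>+x. g (x - \<Phi> p) * f x \<partial>lborel)
        = (\<integral>\<^sup>+x. g (x - \<Phi> p) * f x \<partial>distr lborel borel ((+) (\<Phi> p)))"
      by (simp only: lborel_distr_plus)
    also have "\<dots> = (\<integral>\<^sup>+x. g x * f (x + \<Phi> p) \<partial>lborel)"
      by (subst nn_integral_distr) (simp_all add: add.commute)
    finally show "(\<integral>\<^sup>+x. g x * f (x + \<Phi> p) \<partial>lborel) = (\<integral>\<^sup>+x. g (x - \<Phi> p) * f x \<partial>lborel)" ..
  qed
  also have "\<dots> = (\<integral>\<^sup>+x. \<integral>\<^sup>+p. g (- x + \<Phi> p) * f x \<partial>?P \<partial>lborel)"
    unfolding even by (subst XP.Fubini') simp_all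
  also have "\<dots> = (\<integral>\<^sup>+x. f x \<partial>lborel)"
    using inv[OF g, of "- x" for x] by (simp add: nn_integral_multc g_P)
  finally show ?thesis by (simp add: iter)
qed

subsection \<open>Poisson expectations of fourth-order sums\<close>

definition quads :: "'b set \<Rightarrow> ('b \<times> 'b \<times> 'b \<times> 'b) set" where
  "quads V = {(a, b, c, d). a \<in> V \<and> b \<in> V \<and> c \<in> V \<and> d \<in> V \<and> distinct [a, b, c, d]}"

lemma finite_quads: "finite V \<Longrightarrow> finite (quads V)"
  by (rule finite_subset[of _ "V \<times> V \<times> V \<times> V"]) (auto simp: quads_def)

text \<open>A falling factorial, counted through lists with distinct entries. The argument
  \<open>n + 4\<close> and the factor \<open>fact n\<close> avoid truncated subtraction and
  division, and match the Poisson weight.\<close>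

lemma card_quads_lessThan: "card (quads {..<n + 4}) * fact n = fact (n + 4)"
proof -
  have "card (quads {..<n + 4}) = card {xs. length xs = 4 \<and> distinct xs \<and> set xs \<subseteq> {..<n + 4}}"
  proof (rule bij_betw_same_card)
    show "bij_betw (\<lambda>(a, b, c, d). [a, b, c, d]) (quads {..<n + 4})
        {xs. length xs = 4 \<and> distinct xs \<and> set xs \<subseteq> {..<n + 4}}"
      unfolding bij_betw_def
    proof
      show "inj_on (\<lambda>(a, b, c, d). [a, b, c, d]) (quads {..<n + 4})"
        by (auto simp: inj_on_def)
      show "(\<lambda>(a, b, c, d). [a, b, c, d]) ` quads {..<n + 4} =
          {xs. length xs = 4 \<and> distinct xs \<and> set xs \<subseteq> {..<n + 4}}"
      proof (intro equalityI subsetI)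
        fix xs assume "xs \<in> {xs. length xs = 4 \<and> distinct xs \<and> set xs \<subseteq> {..<n + 4}}"
        then have xs: "length xs = 4" "distinct xs" "set xs \<subseteq> {..<n + 4}" by auto
        from xs(1) obtain a b c d where "xs = [a, b, c, d]"
          by (auto simp: numeral_eq_Suc length_Suc_conv)
        with xs show "xs \<in> (\<lambda>(a, b, c, d). [a, b, c, d]) ` quads {..<n + 4}"
          by (auto simp: quads_def image_iff)
      qed (auto simp: quads_def)
    qed
  qed
  also have "\<dots> = \<Prod>{n + 1..n + 4}"
    by (subst card_lists_distinct_length_eq) simp_all
  also have "\<dots> = (n + 1) * (n + 2) * (n + 3) * (n + 4)"
    by (simp add: numeral_eq_Suc atLeastAtMostSuc_conv algebra_simps)
  finally show ?thesis by (simp add: numeral_eq_Suc algebra_simps)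
qed

lemma quads_lessThan_empty:
  assumes "n < (4::nat)"
  shows "quads {..<n} = {}"
proof (rule ccontr)
  assume "quads {..<n} \<noteq> {}"
  then obtain a b c d where "distinct [a, b, c, d]" and *: "set [a, b, c, d] \<subseteq> {..<n}"
    by (auto simp: quads_def)
  then have "card (set [a, b, c, d]) = 4" by (simp only: distinct_card) simp
  then show False using card_mono[OF _ *] assms by simp
qed

text \<open>Shifting the index by 4 cancels the falling factorial against
  \<open>fact (n + 4)\<close> and leaves an exponential series; the first four terms vanish because
  fewer than four indices admit no distinct quadruple.\<close>

lemma poisson_factorial_moment4:
  "(\<lambda>n. t ^ n / fact n * exp (- t) * (real (card (quads {..<n})) * c)) sums (t ^ 4 * c)"
proof -
  have "(\<lambda>n. t ^ 4 * exp (- t) * c * (t ^ n /\<^sub>R fact n)) sums (t ^ 4 * exp (- t) * c * exp t)"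
    by (intro sums_mult exp_converges)
  also have "t ^ 4 * exp (- t) * c * exp t = t ^ 4 * c"
    by (simp add: exp_minus)
  also have "(\<lambda>n. t ^ 4 * exp (- t) * c * (t ^ n /\<^sub>R fact n))
      = (\<lambda>n. t ^ (n + 4) / fact (n + 4) * exp (- t) * (real (card (quads {..<n + 4})) * c))"
  proof
    fix n
    have "real (card (quads {..<n + 4})) * fact n = fact (n + 4)"
      using arg_cong[OF card_quads_lessThan[of n], of real] by simp
    then show "t ^ 4 * exp (- t) * c * (t ^ n /\<^sub>R fact n)
      = t ^ (n + 4) / fact (n + 4) * exp (- t) * (real (card (quads {..<n + 4})) * c)"
      by (simp add: field_simps power_add del: fact_Suc)
  qed
  finally have "(\<lambda>n. t ^ (n + 4) / fact (n + 4) * exp (- t) * (real (card (quads {..<n + 4})) * c))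
      sums (t ^ 4 * c)" .
  then show ?thesis
    by (subst (asm) sums_iff_shift) (simp add: quads_lessThan_empty)
qed

text \<open>Enumerating the points of \<open>p ` {..<n}\<close> by first occurrences keeps the sum over the
  vertex set measurable also where points coincide.\<close>

definition first_occ :: "(nat \<Rightarrow> 'b) \<Rightarrow> nat \<Rightarrow> bool" where
  "first_occ p i \<longleftrightarrow> (\<forall>j<i. p j \<noteq> p i)"

lemma first_occ_bij: "bij_betw p {i. i < n \<and> first_occ p i} (p ` {..<n})"
  unfolding bij_betw_def
proof
  show "inj_on p {i. i < n \<and> first_occ p i}"
    unfolding inj_on_def first_occ_def by (metis (mono_tags, lifting) mem_Collect_eq nat_neq_iff)
  show "p ` {i. i < n \<and> first_occ p i} = p ` {..<n}"
  proof (intro equalityI subsetI)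
    fix x assume "x \<in> p ` {..<n}"
    then obtain i where i: "i < n" "x = p i" by auto
    define m where "m = (LEAST j. p j = x)"
    have m: "p m = x" unfolding m_def by (rule LeastI[of _ i]) (simp add: i)
    have "m \<le> i" unfolding m_def by (rule Least_le) (simp add: i)
    moreover have "p j \<noteq> x" if "j < m" for j
      using that unfolding m_def by (rule not_less_Least)
    then have "first_occ p m" using m by (simp add: first_occ_def)
    ultimately show "x \<in> p ` {i. i < n \<and> first_occ p i}"
      using m i by (intro image_eqI[of _ _ m]) auto
  qed auto
qed

text \<open>Holds for every \<open>p\<close>, with or without repetitions. The index set on the
  right does not depend on \<open>p\<close>, so sum and integral can be exchanged.\<close>

lemma sum_quads_image:
  fixes H :: "'b \<times> 'b \<times> 'b \<times> 'b \<Rightarrow> real"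
  shows "(\<Sum>q\<in>quads (p ` {..<n}). H q) = (\<Sum>(i, j, k, l)\<in>quads {..<n}.
     if first_occ p i \<and> first_occ p j \<and> first_occ p k \<and> first_occ p l
     then H (p i, p j, p k, p l) else 0)"
proof -
  let ?I = "{i. i < n \<and> first_occ p i}"
  have inj: "inj_on p ?I" and im: "p ` ?I = p ` {..<n}"
    using first_occ_bij[of p n] by (auto simp: bij_betw_def)
  have bij: "bij_betw (\<lambda>(i, j, k, l). (p i, p j, p k, p l)) (quads ?I) (quads (p ` ?I))"
    unfolding bij_betw_def
  proof
    show "inj_on (\<lambda>(i, j, k, l). (p i, p j, p k, p l)) (quads ?I)"
      using inj by (auto simp: inj_on_def quads_def)
    show "(\<lambda>(i, j, k, l). (p i, p j, p k, p l)) ` quads ?I = quads (p ` ?I)"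
    proof (intro equalityI subsetI)
      fix q assume "q \<in> (\<lambda>(i, j, k, l). (p i, p j, p k, p l)) ` quads ?I"
      then obtain i j k l where q: "q = (p i, p j, p k, p l)"
        and "{i, j, k, l} \<subseteq> ?I" "distinct [i, j, k, l]" by (auto simp: quads_def)
      then show "q \<in> quads (p ` ?I)"
        using inj by (auto simp: quads_def inj_on_def)
    next
      fix q assume "q \<in> quads (p ` ?I)"
      then obtain i j k l where "q = (p i, p j, p k, p l)"
        "i \<in> ?I" "j \<in> ?I" "k \<in> ?I" "l \<in> ?I" "distinct [p i, p j, p k, p l]"
        by (auto simp: quads_def)
      then show "q \<in> (\<lambda>(i, j, k, l). (p i, p j, p k, p l)) ` quads ?I"
        by (intro image_eqI[of _ _ "(i, j, k, l)"]) (auto simp: quads_def)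
    qed
  qed
  have "(\<Sum>q\<in>quads (p ` {..<n}). H q) = (\<Sum>(i, j, k, l)\<in>quads ?I. H (p i, p j, p k, p l))"
    unfolding im[symmetric]
    by (subst sum.reindex_bij_betw[OF bij, symmetric]) (simp add: case_prod_unfold)
  also have "\<dots> = (\<Sum>(i, j, k, l)\<in>quads {..<n}.
     if first_occ p i \<and> first_occ p j \<and> first_occ p k \<and> first_occ p l
     then H (p i, p j, p k, p l) else 0)"
    by (rule sum.mono_neutral_cong_left) (auto simp: finite_quads, auto simp: quads_def)
  finally show ?thesis .
qed

section \<open>Independent uniform points in a body of unit volume\<close>

locale unit_body =
  fixes W :: "'a::euclidean_space set"
  assumes compact_W: "compact W" and measure_W: "measure lborel W = 1"
begin

abbreviation U :: "'a measure" where "U \<equiv> uniform_measure lborel W"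

lemma emeasure_W: "emeasure lborel W = 1"
  using emeasure_eq_ennreal_measure[of lborel W] emeasure_compact_finite[OF compact_W] measure_W
  by simp

lemma sets_W [measurable]: "W \<in> sets borel"
  using compact_W by (rule borel_compact)

lemma prob_space_U: "prob_space U"
  by (rule prob_space_uniform_measure) (simp_all add: emeasure_W)

sublocale U: prob_space U by (rule prob_space_U)

sublocale UP: product_prob_space "\<lambda>_::nat. U" by unfold_locales

lemma sets_U [measurable_cong]: "sets U = sets borel"
  by simp

lemma nn_integral_U:
  assumes [measurable]: "f \<in> borel_measurable borel"
  shows "(\<integral>\<^sup>+x. f x \<partial>U) = (\<integral>\<^sup>+x. f x * indicator W x \<partial>lborel)"
  by (subst nn_integral_uniform_measure) (simp_all add: emeasure_W divide_ennreal_def)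

lemma AE_U_neq: "AE x in U. x \<noteq> c"
  by (rule AE_uniform_measureI) (use AE_lborel_singleton[of c] in auto)

lemma measurable_component_eq:
  assumes "i < n" "j < (n::nat)"
  shows "Measurable.pred (PiM {..<n} (\<lambda>_. U)) (\<lambda>p. p i = p j)"
proof -
  have "(\<lambda>p. norm (p i - p j)) \<in> borel_measurable (PiM {..<n} (\<lambda>_. U))"
    using measurable_component_singleton[of i "{..<n}" "\<lambda>_. U"]
      measurable_component_singleton[of j "{..<n}" "\<lambda>_. U"] assms
    by simp
  then have "Measurable.pred (PiM {..<n} (\<lambda>_. U)) (\<lambda>p. norm (p i - p j) = 0)"
    by measurable
  then show ?thesis by simp
qed

text \<open>Coordinate \<open>i\<close> is integrated innermost: with the others fixed,
  \<open>p i = p j\<close> confines it to a single point, which is null for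
  \<open>U\<close>.\<close>

lemma AE_PiM_neq:
  assumes ij: "i < n" "j < n" "i \<noteq> (j::nat)"
  shows "AE p in PiM {..<n} (\<lambda>_. U). p i \<noteq> p j"
proof -
  have n: "{..<n} = insert i ({..<n} - {i})" using ij by auto
  note measurable_component_eq[OF ij(1,2), measurable]
  have "(\<integral>\<^sup>+p. indicator {p. p i = p j} p \<partial>PiM {..<n} (\<lambda>_. U))
      = (\<integral>\<^sup>+x. \<integral>\<^sup>+y. indicator {p. p i = p j} (x(i := y)) \<partial>U \<partial>PiM ({..<n} - {i}) (\<lambda>_. U))"
    using UP.product_nn_integral_insert[of "{..<n} - {i}" i "indicator {p. p i = p j}"] n
    by simp
  also have "\<dots> = 0"
  proof -
    have "(\<integral>\<^sup>+y. indicator {p. p i = p j} (x(i := y)) \<partial>U) = 0" for x :: "nat \<Rightarrow> 'a"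
    proof -
      have "(\<integral>\<^sup>+y. indicator {p. p i = p j} (x(i := y)) \<partial>U) = (\<integral>\<^sup>+y. 0 \<partial>U)"
        by (rule nn_integral_cong_AE) (use AE_U_neq[of "x j"] ij in \<open>auto elim!: eventually_mono\<close>)
      then show ?thesis by simp
    qed
    then show ?thesis by simp
  qed
  finally have "AE p in PiM {..<n} (\<lambda>_. U). indicator {p. p i = p j} p = (0::ennreal)"
    by (subst (asm) nn_integral_0_iff_AE) simp_all
  then show ?thesis by (rule eventually_mono) (auto simp: indicator_def split: if_splits)
qed

lemma AE_PiM_first_occ:
  "AE p in PiM {..<n} (\<lambda>_. U). \<forall>i\<in>{..<n}. first_occ p i"
proof (rule AE_finite_allI)
  fix i assume i: "i \<in> {..<n}"
  have "AE p in PiM {..<n} (\<lambda>_. U). \<forall>j\<in>{..<i}. p j \<noteq> p i"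
    by (rule AE_finite_allI) (use i in \<open>auto intro!: AE_PiM_neq\<close>)
  then show "AE p in PiM {..<n} (\<lambda>_. U). first_occ p i"
    by (simp add: first_occ_def Ball_def)
qed simp

lemma measurable_quad:
  assumes [measurable]: "H \<in> borel_measurable (borel :: ('a \<times> 'a \<times> 'a \<times> 'a) measure)"
    and "i < n" "j < n" "k < n" "l < (n::nat)"
  shows "(\<lambda>p. H (p i, p j, p k, p l)) \<in> borel_measurable (PiM {..<n} (\<lambda>_. U))"
proof -
  have c: "(\<lambda>p. p m) \<in> borel_measurable (PiM {..<n} (\<lambda>_. U))" if "m < n" for m
    using measurable_component_singleton[of m "{..<n}" "\<lambda>_. U"] that by simp
  have "(\<lambda>p. (p i, p j, p k, p l)) \<in> borel_measurable (PiM {..<n} (\<lambda>_. U))"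
    by (intro borel_measurable_Pair c assms)
  from measurable_compose[OF this assms(1)] show ?thesis .
qed

text \<open>Any four distinct coordinates of an i.i.d. sample are again an i.i.d. sample: the
  product measure is pushed forward along the injection \<open>f\<close> of \<open>{..<4}\<close>
  into \<open>{..<n}\<close>.\<close>

lemma integral_quad_reindex:
  assumes H: "H \<in> borel_measurable (borel :: ('a \<times> 'a \<times> 'a \<times> 'a) measure)"
    and q: "(i, j, k, l) \<in> quads {..<n}"
  shows "(\<integral>p. H (p i, p j, p k, p l) \<partial>PiM {..<n} (\<lambda>_. U))
       = (\<integral>p. H (p 0, p 1, p 2, p 3) \<partial>PiM {..<4::nat} (\<lambda>_. U) :: real)"
proof -
  define f where "f = (\<lambda>m::nat. [i, j, k, l] ! m)"
  have f: "f 0 = i" "f 1 = j" "f 2 = k" "f 3 = l"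
    by (simp_all add: f_def numeral_eq_Suc)
  have "inj_on f {..<4}"
    unfolding f_def using q by (intro inj_on_nth) (auto simp: quads_def)
  moreover have mem: "f m < n" if "m < 4" for m
    using nth_mem[of m "[i, j, k, l]"] that q by (auto simp: f_def quads_def)
  ultimately have *: "distr (PiM {..<n} (\<lambda>_. U)) (PiM {..<4} (\<lambda>_. U)) (\<lambda>\<omega>. \<lambda>m\<in>{..<4}. \<omega> (f m))
      = PiM {..<4} (\<lambda>_. U)"
    by (intro distr_PiM_reindex) (auto intro: prob_space_U)
  have [measurable]: "(\<lambda>\<omega>. \<lambda>m\<in>{..<4}. \<omega> (f m)) \<in> PiM {..<n} (\<lambda>_. U) \<rightarrow>\<^sub>M PiM {..<4} (\<lambda>_. U)"
    using mem by (intro measurable_restrict measurable_component_singleton) auto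
  have "(\<integral>p. H (p 0, p 1, p 2, p 3) \<partial>PiM {..<4::nat} (\<lambda>_. U))
      = (\<integral>p. H (p (f 0), p (f 1), p (f 2), p (f 3)) \<partial>PiM {..<n} (\<lambda>_. U))"
    by (subst *[symmetric], subst integral_distr) (auto intro!: measurable_quad H)
  then show ?thesis unfolding f by (rule sym)
qed

lemma integral_sum_quads_image:
  fixes H :: "'a \<times> 'a \<times> 'a \<times> 'a \<Rightarrow> real"
  assumes H [measurable]: "H \<in> borel_measurable borel" and bnd: "\<And>q. \<bar>H q\<bar> \<le> B"
  shows "(\<integral>p. (\<Sum>q\<in>quads (p ` {..<n}). H q) \<partial>PiM {..<n} (\<lambda>_::nat. U))
       = real (card (quads {..<n})) * (\<integral>p. H (p 0, p 1, p 2, p 3) \<partial>PiM {..<4::nat} (\<lambda>_. U))"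
proof -
  interpret P: prob_space "PiM {..<n} (\<lambda>_. U)"
    by (intro prob_space_PiM prob_space_U)
  have [measurable]: "(\<lambda>p. H (p i, p j, p k, p l)) \<in> borel_measurable (PiM {..<n} (\<lambda>_. U))"
    if "(i, j, k, l) \<in> quads {..<n}" for i j k l :: nat
    using that by (intro measurable_quad H) (auto simp: quads_def)
  have [measurable]: "Measurable.pred (PiM {..<n} (\<lambda>_. U)) (\<lambda>p. first_occ p i)" if "i < n" for i :: nat
  proof -
    have "Measurable.pred (PiM {..<n} (\<lambda>_. U)) (\<lambda>p. \<forall>j\<in>{..<i}. \<not> p j = p i)"
    proof (rule pred_intros_finite)
      fix j assume "j \<in> {..<i}"
      then have "j < n" using that by simp
      note measurable_component_eq[OF this that, measurable]
      show "Measurable.pred (PiM {..<n} (\<lambda>_. U)) (\<lambda>p. \<not> p j = p i)"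
        by measurable
    qed simp
    moreover have "(\<lambda>p. first_occ p i) = (\<lambda>p :: nat \<Rightarrow> 'a. \<forall>j\<in>{..<i}. \<not> p j = p i)"
      by (auto simp: first_occ_def)
    ultimately show ?thesis by (simp only:)
  qed
  have "(\<integral>p. (\<Sum>q\<in>quads (p ` {..<n}). H q) \<partial>PiM {..<n} (\<lambda>_. U))
      = (\<integral>p. (\<Sum>(i, j, k, l)\<in>quads {..<n}. H (p i, p j, p k, p l)) \<partial>PiM {..<n} (\<lambda>_. U))"
    unfolding sum_quads_image
  proof (rule integral_cong_AE)
    show "AE p in PiM {..<n} (\<lambda>_. U). (\<Sum>(i, j, k, l)\<in>quads {..<n}.
         if first_occ p i \<and> first_occ p j \<and> first_occ p k \<and> first_occ p l
         then H (p i, p j, p k, p l) else 0) = (\<Sum>(i, j, k, l)\<in>quads {..<n}. H (p i, p j, p k, p l))"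
      using AE_PiM_first_occ by (rule eventually_mono) (auto intro!: sum.cong simp: quads_def)
  next
    show "(\<lambda>p. \<Sum>(i, j, k, l)\<in>quads {..<n}.
         if first_occ p i \<and> first_occ p j \<and> first_occ p k \<and> first_occ p l
         then H (p i, p j, p k, p l) else 0) \<in> borel_measurable (PiM {..<n} (\<lambda>_. U))"
    proof (rule borel_measurable_sum)
      fix q assume q: "q \<in> quads {..<n}"
      obtain i j k l where ijkl: "q = (i, j, k, l)" by (cases q)
      then have [simp]: "i < n" "j < n" "k < n" "l < n" and "(i, j, k, l) \<in> quads {..<n}"
        using q by (auto simp: quads_def)
      then show "(\<lambda>p. case q of (i, j, k, l) \<Rightarrow>
         if first_occ p i \<and> first_occ p j \<and> first_occ p k \<and> first_occ p l
         then H (p i, p j, p k, p l) else 0) \<in> borel_measurable (PiM {..<n} (\<lambda>_. U))"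
        unfolding ijkl prod.case by measurable
    qed
  next
    show "(\<lambda>p. \<Sum>(i, j, k, l)\<in>quads {..<n}. H (p i, p j, p k, p l))
        \<in> borel_measurable (PiM {..<n} (\<lambda>_. U))"
      by (rule borel_measurable_sum) auto
  qed
  also have "\<dots> = (\<Sum>q\<in>quads {..<n}. \<integral>p. (case q of (i, j, k, l) \<Rightarrow> H (p i, p j, p k, p l))
      \<partial>PiM {..<n} (\<lambda>_. U))"
    by (rule Bochner_Integration.integral_sum)
      (auto intro!: P.integrable_const_bound[where B = B] bnd)
  also have "\<dots> = (\<Sum>q\<in>quads {..<n}. \<integral>p. H (p 0, p 1, p 2, p 3) \<partial>PiM {..<4::nat} (\<lambda>_. U))"
    by (rule sum.cong[OF refl], clarify, rule integral_quad_reindex[OF H])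
  finally show ?thesis by simp
qed

text \<open>This is the multivariate Mecke formula of order four, for an integrand that depends on
  the process only through the four points.\<close>

lemma poisson_exp_sum_quads:
  fixes H :: "'a \<times> 'a \<times> 'a \<times> 'a \<Rightarrow> real"
  assumes "H \<in> borel_measurable borel" and "\<And>q. \<bar>H q\<bar> \<le> B"
  shows "poisson_exp t W (\<lambda>V. r * (\<Sum>q\<in>quads V. H q))
       = t ^ 4 * (r * (\<integral>p. H (p 0, p 1, p 2, p 3) \<partial>PiM {..<4::nat} (\<lambda>_. U)))"
proof -
  let ?J = "\<integral>p. H (p 0, p 1, p 2, p 3) \<partial>PiM {..<4::nat} (\<lambda>_. U)"
  have "poisson_exp t W (\<lambda>V. r * (\<Sum>q\<in>quads V. H q))
      = (\<Sum>n. t ^ n / fact n * exp (- t) * (real (card (quads {..<n})) * (r * ?J)))"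
    unfolding poisson_exp_def integral_mult_right_zero integral_sum_quads_image[OF assms]
    by (simp only: mult.left_commute[of r])
  also have "\<dots> = t ^ 4 * (r * ?J)"
    by (rule sums_unique[symmetric, OF poisson_factorial_moment4])
  finally show ?thesis .
qed

lemma nn_integral_PiM4:
  fixes H :: "'a \<times> 'a \<times> 'a \<times> 'a \<Rightarrow> ennreal"
  assumes H [measurable]: "H \<in> borel_measurable borel"
  shows "(\<integral>\<^sup>+p. H (p 0, p 1, p 2, p 3) \<partial>PiM {..<4::nat} (\<lambda>_. U))
       = (\<integral>\<^sup>+a. \<integral>\<^sup>+b. \<integral>\<^sup>+c. \<integral>\<^sup>+d. H (a, b, c, d) \<partial>U \<partial>U \<partial>U \<partial>U)"
proof -
  have c: "(\<lambda>p. p m) \<in> borel_measurable (PiM I (\<lambda>_. U))" if "m \<in> I" for m :: nat and I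
    using measurable_component_singleton[of m I "\<lambda>_. U"] that by simp
  note m = measurable_compose[OF borel_measurable_Pair assms]
  have s: "{..<4::nat} = insert 0 {1, 2, 3}" by auto
  have 0: "(\<integral>\<^sup>+p. H (p 0, p 1, p 2, p 3) \<partial>PiM {..<4::nat} (\<lambda>_. U))
      = (\<integral>\<^sup>+a. \<integral>\<^sup>+p. H (a, p 1, p 2, p 3) \<partial>PiM {1, 2, 3::nat} (\<lambda>_. U) \<partial>U)"
    unfolding s
    by (subst UP.product_nn_integral_insert_rev) (auto intro!: m borel_measurable_Pair c)
  have 1: "(\<integral>\<^sup>+p. H (a, p 1, p 2, p 3) \<partial>PiM {1, 2, 3::nat} (\<lambda>_. U))
      = (\<integral>\<^sup>+b. \<integral>\<^sup>+p. H (a, b, p 2, p 3) \<partial>PiM {2, 3::nat} (\<lambda>_. U) \<partial>U)" for a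
    by (subst UP.product_nn_integral_insert_rev) (auto intro!: m borel_measurable_Pair c)
  have 2: "(\<integral>\<^sup>+p. H (a, b, p 2, p 3) \<partial>PiM {2, 3::nat} (\<lambda>_. U))
      = (\<integral>\<^sup>+c. \<integral>\<^sup>+p. H (a, b, c, p 3) \<partial>PiM {3::nat} (\<lambda>_. U) \<partial>U)" for a b
    by (subst UP.product_nn_integral_insert_rev) (auto intro!: m borel_measurable_Pair c)
  have 3: "(\<integral>\<^sup>+p. H (a, b, c, p 3) \<partial>PiM {3::nat} (\<lambda>_. U)) = (\<integral>\<^sup>+d. H (a, b, c, d) \<partial>U)"
    for a b c
    by (rule UP.product_nn_integral_singleton[of "\<lambda>d. H (a, b, c, d)"])
      (auto intro!: m borel_measurable_Pair)
  show ?thesis by (simp only: 0 1 2 3)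
qed

end

subsection \<open>Crossings of projected segments\<close>

text \<open>Copies the condition inside \<open>cd_const\<close>, so that unfolding identifies the
  two. \<open>y\<close> is not projected, since it stands for an offset inside
  \<open>L\<close>.\<close>

definition crossing :: "'a::euclidean_space set \<Rightarrow> 'a \<Rightarrow> 'a \<Rightarrow> 'a \<Rightarrow> bool" where
  "crossing L x y z \<longleftrightarrow>
     oproj L ` closed_segment 0 x \<inter> ((\<lambda>w. y + w) ` oproj L ` closed_segment 0 z) \<noteq> {}"

locale subspace_projection =
  fixes L :: "'a::euclidean_space set"
  assumes L: "subspace L"
begin

lemma oproj_closed_segment:
  "oproj L ` closed_segment v (v + x) = {oproj L v + s *\<^sub>R oproj L x |s. 0 \<le> s \<and> s \<le> 1}"
proof -
  have "oproj L ((1 - s) *\<^sub>R v + s *\<^sub>R (v + x)) = oproj L v + s *\<^sub>R oproj L x" for s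
    using linear_add[OF linear_oproj[OF L]] linear_scale[OF linear_oproj[OF L]]
    by (simp add: algebra_simps flip: scaleR_add_left)
  then show ?thesis
    by (auto simp: closed_segment_def image_def)
qed

lemma crossing_iff:
  "crossing L x y z \<longleftrightarrow>
     (\<exists>s t. 0 \<le> s \<and> s \<le> 1 \<and> 0 \<le> t \<and> t \<le> 1 \<and> s *\<^sub>R oproj L x = y + t *\<^sub>R oproj L z)"
proof -
  have S: "oproj L ` closed_segment 0 v = {s *\<^sub>R oproj L v |s. 0 \<le> s \<and> s \<le> 1}" for v
    using oproj_closed_segment[of 0 v] linear_0[OF linear_oproj[OF L]] by simp
  have "crossing L x y z \<longleftrightarrow>
      (\<exists>p\<in>oproj L ` closed_segment 0 x. \<exists>q\<in>oproj L ` closed_segment 0 z. p = y + q)"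
    unfolding crossing_def by blast
  then show ?thesis unfolding S by blast
qed

text \<open>By linearity of the projection, only the two edge vectors and the projected offset of
  the starting points matter. This separates the shape of a crossing from its position in
  \<open>W\<close>.\<close>

lemma segments_meet_iff_crossing:
  "oproj L ` closed_segment a b \<inter> oproj L ` closed_segment c d \<noteq> {}
     \<longleftrightarrow> crossing L (b - a) (oproj L (c - a)) (d - c)"
proof -
  have "oproj L ` closed_segment a b \<inter> oproj L ` closed_segment c d \<noteq> {} \<longleftrightarrow>
      (\<exists>s t. 0 \<le> s \<and> s \<le> 1 \<and> 0 \<le> t \<and> t \<le> 1 \<and>
        oproj L a + s *\<^sub>R oproj L (b - a) = oproj L c + t *\<^sub>R oproj L (d - c))"
    using oproj_closed_segment[of a "b - a"] oproj_closed_segment[of c "d - c"] by auto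
  also have "\<dots> \<longleftrightarrow> crossing L (b - a) (oproj L (c - a)) (d - c)"
    unfolding crossing_iff linear_diff[OF linear_oproj[OF L], of c a]
    by (simp add: algebra_simps)
  finally show ?thesis .
qed

text \<open>The condition is an equation linear in \<open>x\<close>, \<open>y\<close>,
  \<open>z\<close> jointly, with the same parameters \<open>s\<close>, \<open>t\<close> on both
  scales.\<close>

lemma crossing_scaleR:
  assumes "r > 0"
  shows "crossing L (r *\<^sub>R x) (r *\<^sub>R y) (r *\<^sub>R z) \<longleftrightarrow> crossing L x y z"
proof -
  have "s *\<^sub>R oproj L (r *\<^sub>R x) = r *\<^sub>R y + t *\<^sub>R oproj L (r *\<^sub>R z) \<longleftrightarrow>
      r *\<^sub>R (s *\<^sub>R oproj L x) = r *\<^sub>R (y + t *\<^sub>R oproj L z)" for s t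
    by (simp add: linear_scale[OF linear_oproj[OF L]] scaleR_add_right mult.commute)
  then show ?thesis using assms unfolding crossing_iff by (simp only: scaleR_cancel_left) simp
qed

text \<open>Projection does not increase norms, so \<open>y\<close> is a difference of two vectors
  of norm at most 1. This is the origin of the radius 2 in \<open>cd_const\<close>.\<close>

lemma crossing_norm_le:
  assumes "crossing L x y z" "norm x \<le> 1" "norm z \<le> 1"
  shows "norm y \<le> 2"
proof -
  obtain s t where st: "0 \<le> s" "s \<le> 1" "0 \<le> t" "t \<le> 1"
    and eq: "s *\<^sub>R oproj L x = y + t *\<^sub>R oproj L z"
    using assms(1) by (auto simp: crossing_iff)
  have "norm y = norm (s *\<^sub>R oproj L x - t *\<^sub>R oproj L z)" using eq by simp
  also have "\<dots> \<le> s * norm (oproj L x) + t * norm (oproj L z)"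
    using norm_triangle_ineq4[of "s *\<^sub>R oproj L x" "t *\<^sub>R oproj L z"] st by simp
  also have "\<dots> \<le> 1 * 1 + 1 * 1"
    using st assms(2,3) norm_oproj_le[OF L, of x] norm_oproj_le[OF L, of z]
    by (intro add_mono mult_mono) auto
  finally show ?thesis by simp
qed

lemma continuous_oproj [continuous_intros]:
  "continuous_on S f \<Longrightarrow> continuous_on S (\<lambda>x. oproj L (f x))"
  using linear_oproj[OF L]
  by (simp add: linear_conv_bounded_linear bounded_linear.continuous_on)

text \<open>The parameters \<open>s\<close>, \<open>t\<close> range over a compact square, and
  projecting a closed set along a compact factor keeps it closed. Measurability of the crossing
  events rests on this.\<close>

lemma closed_crossing: "closed {(x, y, z). crossing L x y z}"
proof -
  let ?T = "{p :: (real \<times> real) \<times> 'a \<times> 'a \<times> 'a.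
     fst (fst p) *\<^sub>R oproj L (fst (snd p))
       = fst (snd (snd p)) + snd (fst p) *\<^sub>R oproj L (snd (snd (snd p)))}"
  have "closed ?T"
    by (intro closed_Collect_eq continuous_intros)
  from closed_compact_projection[OF compact_Times[OF compact_Icc[of 0 1] compact_Icc[of 0 1]] this]
  have "closed {q. \<exists>st. st \<in> {0..1} \<times> {0..1} \<and> (st, q) \<in> ?T}" .
  moreover have "{q. \<exists>st. st \<in> {0..1} \<times> {0..1} \<and> (st, q) \<in> ?T} = {(x, y, z). crossing L x y z}"
    by (auto simp: crossing_iff) blast+
  ultimately show ?thesis by simp
qed

lemma closed_Collect_crossing:
  assumes "continuous_on UNIV f" "continuous_on UNIV g" "continuous_on UNIV h"
  shows "closed {p. crossing L (f p) (g p) (h p)}"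
proof -
  have "continuous_on UNIV (\<lambda>p. (f p, g p, h p))"
    using assms by (intro continuous_intros)
  from closed_vimage[OF closed_crossing this] show ?thesis by (simp add: vimage_def)
qed

subsection \<open>Local coordinates for two short edges\<close>

lemma nn_integral_lborel_affine:
  fixes f :: "'a \<Rightarrow> ennreal"
  assumes r: "r > 0" and [measurable]: "f \<in> borel_measurable borel"
  shows "(\<integral>\<^sup>+b. f b \<partial>lborel) = ennreal (r ^ DIM('a)) * (\<integral>\<^sup>+x. f (a + r *\<^sub>R x) \<partial>lborel)"
  by (subst lborel_affine[of r a])
    (use r in \<open>simp_all add: nn_integral_density nn_integral_distr nn_integral_cmult\<close>)

abbreviation \<phi> :: "(nat \<Rightarrow> real) \<Rightarrow> 'a" where "\<phi> \<equiv> flat_param L 0"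
abbreviation \<psi> :: "(nat \<Rightarrow> real) \<Rightarrow> 'a" where "\<psi> \<equiv> flat_param (ocompl L) 0"
abbreviation \<Lambda> :: "(nat \<Rightarrow> real) measure" where "\<Lambda> \<equiv> flat_lborel L"
abbreviation \<Lambda>' :: "(nat \<Rightarrow> real) measure" where "\<Lambda>' \<equiv> flat_lborel (ocompl L)"

sublocale \<Lambda>: sigma_finite_measure \<Lambda> by (rule sigma_finite_flat_lborel)
sublocale \<Lambda>': sigma_finite_measure \<Lambda>' by (rule sigma_finite_flat_lborel)

text \<open>Rescaling \<open>d\<close> around \<open>c\<close> and \<open>b\<close> around
  \<open>a\<close> gives \<open>r ^ DIM('a)\<close> each; rescaling the \<open>L\<close>-part of
  \<open>c\<close> around that of \<open>a\<close> gives \<open>r ^ dim L\<close>. The orthogonal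
  parts \<open>w\<close>, \<open>w'\<close> stay unscaled because the projected drawing does not
  constrain their distance.\<close>

lemma nn_integral_local_coordinates:
  fixes F :: "'a \<times> 'a \<times> 'a \<times> 'a \<Rightarrow> ennreal"
  assumes r: "r > 0" and F: "F \<in> borel_measurable borel"
  shows "(\<integral>\<^sup>+a. \<integral>\<^sup>+b. \<integral>\<^sup>+c. \<integral>\<^sup>+d. F (a, b, c, d) \<partial>lborel \<partial>lborel \<partial>lborel \<partial>lborel)
    = ennreal (r ^ (2 * DIM('a) + dim L)) *
      (\<integral>\<^sup>+u. \<integral>\<^sup>+w. \<integral>\<^sup>+x. \<integral>\<^sup>+y. \<integral>\<^sup>+w'. \<integral>\<^sup>+z.
         F (\<phi> u + \<psi> w, \<phi> u + \<psi> w + r *\<^sub>R x,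
            \<phi> u + r *\<^sub>R \<phi> y + \<psi> w', \<phi> u + r *\<^sub>R \<phi> y + \<psi> w' + r *\<^sub>R z)
         \<partial>lborel \<partial>\<Lambda>' \<partial>\<Lambda> \<partial>lborel \<partial>\<Lambda>' \<partial>\<Lambda>)"
proof -
  have [measurable]: "F \<in> borel_measurable (borel \<Otimes>\<^sub>M borel \<Otimes>\<^sub>M borel \<Otimes>\<^sub>M borel)"
    using F by (simp add: borel_prod)
  let ?D = "ennreal (r ^ DIM('a))"
  let ?E = "ennreal (r ^ dim L)"
  have "(\<integral>\<^sup>+a. \<integral>\<^sup>+b. \<integral>\<^sup>+c. \<integral>\<^sup>+d. F (a, b, c, d) \<partial>lborel \<partial>lborel \<partial>lborel \<partial>lborel)
     = (\<integral>\<^sup>+a. \<integral>\<^sup>+b. \<integral>\<^sup>+c. ?D * (\<integral>\<^sup>+z. F (a, b, c, c + r *\<^sub>R z) \<partial>lborel) \<partial>lborel \<partial>lborel \<partial>lborel)"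
    by (intro nn_integral_cong nn_integral_lborel_affine[OF r]) measurable
  also have "\<dots> = (\<integral>\<^sup>+a. ?D * (\<integral>\<^sup>+x. \<integral>\<^sup>+c. ?D * (\<integral>\<^sup>+z. F (a, a + r *\<^sub>R x, c, c + r *\<^sub>R z) \<partial>lborel)
      \<partial>lborel \<partial>lborel) \<partial>lborel)"
    by (intro nn_integral_cong nn_integral_lborel_affine[OF r]) measurable
  also have "\<dots> = (\<integral>\<^sup>+u. \<integral>\<^sup>+w. ?D * (\<integral>\<^sup>+x. \<integral>\<^sup>+c. ?D * (\<integral>\<^sup>+z. F (\<phi> u + \<psi> w, \<phi> u + \<psi> w + r *\<^sub>R x, c, c + r *\<^sub>R z) \<partial>lborel)
      \<partial>lborel \<partial>lborel) \<partial>\<Lambda>' \<partial>\<Lambda>)"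
    by (rule nn_integral_lborel_decomp[OF L]) measurable
  also have "\<dots> = (\<integral>\<^sup>+u. \<integral>\<^sup>+w. ?D * (\<integral>\<^sup>+x. ?E * (\<integral>\<^sup>+y. \<integral>\<^sup>+w'. ?D * (\<integral>\<^sup>+z.
         F (\<phi> u + \<psi> w, \<phi> u + \<psi> w + r *\<^sub>R x,
            \<phi> u + r *\<^sub>R \<phi> y + \<psi> w', \<phi> u + r *\<^sub>R \<phi> y + \<psi> w' + r *\<^sub>R z)
         \<partial>lborel) \<partial>\<Lambda>' \<partial>\<Lambda>) \<partial>lborel) \<partial>\<Lambda>' \<partial>\<Lambda>)"
  proof (intro nn_integral_cong arg_cong2[where f = "(*)"] refl)
    fix u w x
    let ?G = "\<lambda>c. ?D * (\<integral>\<^sup>+z. F (\<phi> u + \<psi> w, \<phi> u + \<psi> w + r *\<^sub>R x, c, c + r *\<^sub>R z) \<partial>lborel)"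
    have G [measurable]: "?G \<in> borel_measurable borel" by measurable
    have "(\<integral>\<^sup>+c. ?G c \<partial>lborel) = (\<integral>\<^sup>+y. \<integral>\<^sup>+w'. ?G (\<phi> y + \<psi> w') \<partial>\<Lambda>' \<partial>\<Lambda>)"
      by (rule nn_integral_lborel_decomp[OF L G])
    also have "\<dots> = ?E * (\<integral>\<^sup>+y. \<integral>\<^sup>+w'. ?G (\<phi> u + r *\<^sub>R \<phi> y + \<psi> w') \<partial>\<Lambda>' \<partial>\<Lambda>)"
      by (rule nn_integral_flat_affine[OF r _ L flat_param_in[OF L]]) measurable
    finally show "(\<integral>\<^sup>+c. ?G c \<partial>lborel)
      = ?E * (\<integral>\<^sup>+y. \<integral>\<^sup>+w'. ?G (\<phi> u + r *\<^sub>R \<phi> y + \<psi> w') \<partial>\<Lambda>' \<partial>\<Lambda>)" .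
  qed
  also have "\<dots> = ?D * ?D * ?E *
      (\<integral>\<^sup>+u. \<integral>\<^sup>+w. \<integral>\<^sup>+x. \<integral>\<^sup>+y. \<integral>\<^sup>+w'. \<integral>\<^sup>+z.
         F (\<phi> u + \<psi> w, \<phi> u + \<psi> w + r *\<^sub>R x,
            \<phi> u + r *\<^sub>R \<phi> y + \<psi> w', \<phi> u + r *\<^sub>R \<phi> y + \<psi> w' + r *\<^sub>R z)
         \<partial>lborel \<partial>\<Lambda>' \<partial>\<Lambda> \<partial>lborel \<partial>\<Lambda>' \<partial>\<Lambda>)"
    by (simp add: nn_integral_cmult mult_ac)
  also have "?D * ?D * ?E = ennreal (r ^ (2 * DIM('a) + dim L))"
    using r by (simp add: ennreal_mult[symmetric] power_add mult_2)
  finally show ?thesis .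
qed

end

subsection \<open>The crossing integral\<close>

lemma sigma_finite_pair:
  assumes "sigma_finite_measure M" "sigma_finite_measure N"
  shows "sigma_finite_measure (M \<Otimes>\<^sub>M N)"
proof -
  interpret pair_sigma_finite M N using assms by (rule pair_sigma_finite.intro)
  show ?thesis by unfold_locales
qed

text \<open>Measurability of the section is handed to the last premise, so the rule applies again to
  the section itself; \<open>nn_integral_coord_measure\<close> chains it five times.\<close>

lemma nn_integral_pair_iter:
  assumes "sigma_finite_measure N" and f: "f \<in> borel_measurable (M \<Otimes>\<^sub>M N)"
    and "\<And>u. u \<in> space M \<Longrightarrow> (\<lambda>q. f (u, q)) \<in> borel_measurable N \<Longrightarrow> (\<integral>\<^sup>+q. f (u, q) \<partial>N) = g u"
  shows "(\<integral>\<^sup>+p. f p \<partial>(M \<Otimes>\<^sub>M N)) = (\<integral>\<^sup>+u. g u \<partial>M)"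
  unfolding sigma_finite_measure.nn_integral_fst[OF assms(1,2), symmetric]
  by (intro nn_integral_cong assms(3) measurable_compose_Pair1[OF _ f])

locale drawing = unit_body W + subspace_projection L for W L :: "'a::euclidean_space set"
begin

definition cross_pairs :: "real \<Rightarrow> ('a \<times> 'a \<times> 'a \<times> 'a) set" where
  "cross_pairs r = {(a, b, c, d). norm (a - b) \<le> r \<and> norm (c - d) \<le> r \<and>
     crossing L (b - a) (oproj L (c - a)) (d - c)}"

text \<open>In the scaled picture the two edges run from \<open>u + w\<close> along \<open>r *\<^sub>R x\<close> and from
  \<open>u + r *\<^sub>R y + w'\<close> along \<open>r *\<^sub>R z\<close>, where \<open>u\<close>, \<open>y\<close> lie in \<open>L\<close> and \<open>w\<close>, \<open>w'\<close> in its
  orthogonal complement.\<close>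

definition local_config :: "real \<Rightarrow> ('a \<times> 'a \<times> 'a \<times> 'a \<times> 'a \<times> 'a) set" where
  "local_config r = {(u, w, x, y, w', z). u + w \<in> W \<and> u + w + r *\<^sub>R x \<in> W \<and>
     u + r *\<^sub>R y + w' \<in> W \<and> u + r *\<^sub>R y + w' + r *\<^sub>R z \<in> W \<and>
     norm x \<le> 1 \<and> norm z \<le> 1 \<and> crossing L x y z}"

text \<open>Dominated convergence and almost-everywhere statements need a single measure; the
  factors follow the order of integration in \<open>nn_integral_local_coordinates\<close>.\<close>

definition coord_measure ::
    "((nat \<Rightarrow> real) \<times> (nat \<Rightarrow> real) \<times> 'a \<times> (nat \<Rightarrow> real) \<times> (nat \<Rightarrow> real) \<times> 'a) measure" where
  "coord_measure = \<Lambda> \<Otimes>\<^sub>M (\<Lambda>' \<Otimes>\<^sub>M (lborel \<Otimes>\<^sub>M (\<Lambda> \<Otimes>\<^sub>M (\<Lambda>' \<Otimes>\<^sub>M lborel))))"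

text \<open>Sets of configurations live in a Euclidean space, where closedness gives measurability;
  this map pulls them back to coordinates.\<close>

definition from_coords ::
    "(nat \<Rightarrow> real) \<times> (nat \<Rightarrow> real) \<times> 'a \<times> (nat \<Rightarrow> real) \<times> (nat \<Rightarrow> real) \<times> 'a
      \<Rightarrow> 'a \<times> 'a \<times> 'a \<times> 'a \<times> 'a \<times> 'a" where
  "from_coords = (\<lambda>(u, w, x, y, w', z). (\<phi> u, \<psi> w, x, \<phi> y, \<psi> w', z))"

lemma rect_cr_eq:
  "rect_cr L r V = 1/8 * (\<Sum>q\<in>quads V. indicator (cross_pairs r) q)"
  unfolding rect_cr_def quads_def segments_meet_iff_crossing
  by (intro arg_cong2[where f = "(*)"] refl sum.cong) (auto simp: cross_pairs_def)

lemma closed_W: "closed W"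
  using compact_W by (rule compact_imp_closed)

lemma closed_cross_pairs: "closed (cross_pairs r)"
  unfolding cross_pairs_def case_prod_unfold
  by (intro closed_Collect_conj closed_Collect_crossing closed_Collect_le continuous_intros)

lemma closed_Collect_W: "continuous_on UNIV f \<Longrightarrow> closed {p. f p \<in> W}"
  using closed_vimage[OF closed_W] by (simp add: vimage_def)

lemma closed_local_config: "closed (local_config r)"
  unfolding local_config_def case_prod_unfold
  by (intro closed_Collect_conj closed_Collect_crossing closed_Collect_le closed_Collect_W
      continuous_intros)

lemma measurable_from_coords [measurable]: "from_coords \<in> borel_measurable coord_measure"
  unfolding from_coords_def coord_measure_def case_prod_unfold
  by (intro borel_measurable_Pair) measurable

lemma borel_local_config [measurable]: "local_config r \<in> sets borel"
  using closed_local_config by (rule borel_closed)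

lemma measurable_indicator_local_config:
  "(\<lambda>p. indicator (local_config r) (from_coords p) :: real)
     \<in> borel_measurable coord_measure"
  "(\<lambda>p. indicator (local_config r) (from_coords p) :: ennreal)
     \<in> borel_measurable coord_measure"
  using measurable_compose[OF measurable_from_coords borel_measurable_indicator[OF borel_local_config]]
  by blast+

text \<open>The orthogonal parts vanish in the projection of \<open>c - a\<close>, leaving
  \<open>r *\<^sub>R y\<close>; homogeneity then divides \<open>r\<close> out of the length and
  crossing conditions.\<close>

lemma local_config_iff:
  assumes r: "r > 0" and y: "y \<in> L" and w: "w \<in> ocompl L" "w' \<in> ocompl L"
  shows "(u, w, x, y, w', z) \<in> local_config r \<longleftrightarrow>
    (let a = u + w; b = u + w + r *\<^sub>R x; c = u + r *\<^sub>R y + w'; d = u + r *\<^sub>R y + w' + r *\<^sub>R z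
     in (a, b, c, d) \<in> cross_pairs r \<and> a \<in> W \<and> b \<in> W \<and> c \<in> W \<and> d \<in> W)"
proof -
  have "oproj L (u + r *\<^sub>R y + w' - (u + w)) = r *\<^sub>R y"
    by (rule oproj_unique[OF L])
      (use y w L in \<open>simp_all add: subspace_scale subspace_diff\<close>)
  moreover have "r * s \<le> r \<longleftrightarrow> s \<le> 1" for s
    using r by simp
  ultimately show ?thesis
    using r crossing_scaleR[OF r, of x y z]
    by (auto simp: local_config_def cross_pairs_def Let_def)
qed

lemma sigma_finite_coords:
  "sigma_finite_measure (\<Lambda>' \<Otimes>\<^sub>M (lborel \<Otimes>\<^sub>M (\<Lambda> \<Otimes>\<^sub>M (\<Lambda>' \<Otimes>\<^sub>M (lborel :: 'a measure)))))"
  "sigma_finite_measure (lborel \<Otimes>\<^sub>M (\<Lambda> \<Otimes>\<^sub>M (\<Lambda>' \<Otimes>\<^sub>M (lborel :: 'a measure))) :: ('a \<times> _) measure)"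
  "sigma_finite_measure (\<Lambda> \<Otimes>\<^sub>M (\<Lambda>' \<Otimes>\<^sub>M (lborel :: 'a measure)))"
  "sigma_finite_measure (\<Lambda>' \<Otimes>\<^sub>M (lborel :: 'a measure))"
  by (intro sigma_finite_pair sigma_finite_flat_lborel sigma_finite_lborel)+

lemma nn_integral_coord_measure:
  assumes F: "F \<in> borel_measurable borel"
  shows "(\<integral>\<^sup>+p. F (from_coords p) \<partial>coord_measure)
    = (\<integral>\<^sup>+u. \<integral>\<^sup>+w. \<integral>\<^sup>+x. \<integral>\<^sup>+y. \<integral>\<^sup>+w'. \<integral>\<^sup>+z. F (\<phi> u, \<psi> w, x, \<phi> y, \<psi> w', z)
         \<partial>lborel \<partial>\<Lambda>' \<partial>\<Lambda> \<partial>lborel \<partial>\<Lambda>' \<partial>\<Lambda>)"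
proof -
  have m: "(\<lambda>p. F (from_coords p)) \<in> borel_measurable coord_measure"
    using measurable_compose[OF measurable_from_coords F] .
  have "(\<integral>\<^sup>+p. F (from_coords p) \<partial>coord_measure)
    = (\<integral>\<^sup>+u. \<integral>\<^sup>+w. \<integral>\<^sup>+x. \<integral>\<^sup>+y. \<integral>\<^sup>+w'. \<integral>\<^sup>+z. F (from_coords (u, w, x, y, w', z))
         \<partial>lborel \<partial>\<Lambda>' \<partial>\<Lambda> \<partial>lborel \<partial>\<Lambda>' \<partial>\<Lambda>)"
    unfolding coord_measure_def
    by (rule nn_integral_pair_iter[OF sigma_finite_coords(1) m[unfolded coord_measure_def]],
        rule nn_integral_pair_iter[OF sigma_finite_coords(2)], assumption,
        rule nn_integral_pair_iter[OF sigma_finite_coords(3)], assumption,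
        rule nn_integral_pair_iter[OF sigma_finite_coords(4)], assumption,
        rule nn_integral_pair_iter[OF sigma_finite_lborel], assumption, rule refl)
  then show ?thesis by (simp add: from_coords_def)
qed

lemma nn_integral_U4:
  assumes F: "F \<in> borel_measurable borel"
  shows "(\<integral>\<^sup>+a. \<integral>\<^sup>+b. \<integral>\<^sup>+c. \<integral>\<^sup>+d. F (a, b, c, d) \<partial>U \<partial>U \<partial>U \<partial>U)
    = (\<integral>\<^sup>+a. \<integral>\<^sup>+b. \<integral>\<^sup>+c. \<integral>\<^sup>+d. F (a, b, c, d) * indicator (W \<times> W \<times> W \<times> W) (a, b, c, d)
        \<partial>lborel \<partial>lborel \<partial>lborel \<partial>lborel)"
proof -
  have [measurable]: "F \<in> borel_measurable (borel \<Otimes>\<^sub>M borel \<Otimes>\<^sub>M borel \<Otimes>\<^sub>M borel)"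
    using F by (simp add: borel_prod)
  have "(\<integral>\<^sup>+a. \<integral>\<^sup>+b. \<integral>\<^sup>+c. \<integral>\<^sup>+d. F (a, b, c, d) \<partial>U \<partial>U \<partial>U \<partial>U)
    = (\<integral>\<^sup>+a. (\<integral>\<^sup>+b. (\<integral>\<^sup>+c. (\<integral>\<^sup>+d. F (a, b, c, d) * indicator W d \<partial>lborel) * indicator W c \<partial>lborel)
         * indicator W b \<partial>lborel) * indicator W a \<partial>lborel)"
    by (simp add: nn_integral_U)
  also have "\<dots> = (\<integral>\<^sup>+a. \<integral>\<^sup>+b. \<integral>\<^sup>+c. \<integral>\<^sup>+d. F (a, b, c, d) * indicator W d * indicator W c
      * indicator W b * indicator W a \<partial>lborel \<partial>lborel \<partial>lborel \<partial>lborel)"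
    by (simp add: nn_integral_multc)
  also have "\<dots> = (\<integral>\<^sup>+a. \<integral>\<^sup>+b. \<integral>\<^sup>+c. \<integral>\<^sup>+d. F (a, b, c, d) * indicator (W \<times> W \<times> W \<times> W) (a, b, c, d)
        \<partial>lborel \<partial>lborel \<partial>lborel \<partial>lborel)"
    by (intro nn_integral_cong) (simp add: indicator_times mult_ac)
  finally show ?thesis .
qed

lemma poisson_exp_rect_cr:
  assumes r: "r > 0"
  shows "poisson_exp t W (rect_cr L r) = 1/8 * t ^ 4 * r ^ (2 * DIM('a) + dim L) *
    (\<integral>p. indicator (local_config r) (from_coords p) \<partial>coord_measure)"
proof -
  have cp [measurable]: "cross_pairs r \<in> sets borel"
    using closed_cross_pairs by (rule borel_closed)
  have WW: "W \<times> W \<times> W \<times> W \<in> sets borel"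
    using closed_W by (intro borel_closed closed_Times)
  let ?H = "indicator (cross_pairs r) :: _ \<Rightarrow> real"
  let ?F = "\<lambda>q. indicator (cross_pairs r) q * indicator (W \<times> W \<times> W \<times> W) q :: ennreal"
  have F: "?F \<in> borel_measurable borel"
    by (intro borel_measurable_times_ennreal borel_measurable_indicator cp WW)
  have "(\<integral>\<^sup>+p. ennreal (?H (p 0, p 1, p 2, p 3)) \<partial>PiM {..<4::nat} (\<lambda>_. U))
      = (\<integral>\<^sup>+a. \<integral>\<^sup>+b. \<integral>\<^sup>+c. \<integral>\<^sup>+d. ?F (a, b, c, d) \<partial>lborel \<partial>lborel \<partial>lborel \<partial>lborel)"
    unfolding ennreal_indicator
    by (subst nn_integral_PiM4, simp, subst nn_integral_U4) simp_all
  also have "\<dots> = ennreal (r ^ (2 * DIM('a) + dim L)) *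
      (\<integral>\<^sup>+p. indicator (local_config r) (from_coords p) \<partial>coord_measure)"
  proof -
    have "?F (\<phi> u + \<psi> w, \<phi> u + \<psi> w + r *\<^sub>R x, \<phi> u + r *\<^sub>R \<phi> y + \<psi> w', \<phi> u + r *\<^sub>R \<phi> y + \<psi> w' + r *\<^sub>R z)
      = indicator (local_config r) (\<phi> u, \<psi> w, x, \<phi> y, \<psi> w', z)" for u w y w' :: "nat \<Rightarrow> real" and x z
      using local_config_iff[of r "\<phi> y" "\<psi> w" "\<psi> w'" "\<phi> u" x z] r flat_param_in[OF L, of y]
        flat_param_in[OF subspace_ocompl, of L w] flat_param_in[OF subspace_ocompl, of L w']
      by (auto simp: indicator_def Let_def)
    then show ?thesis
      by (subst nn_integral_local_coordinates[OF r F], subst nn_integral_coord_measure) simp_all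
  qed
  \<comment> \<open>\<open>enn2real\<close> sends infinity to 0, the value of a Bochner integral
    that does not exist, so this conversion is valid before integrability is known.\<close>
  finally have "(\<integral>p. ?H (p 0, p 1, p 2, p 3) \<partial>PiM {..<4::nat} (\<lambda>_. U))
      = enn2real (ennreal (r ^ (2 * DIM('a) + dim L)) *
      (\<integral>\<^sup>+p. indicator (local_config r) (from_coords p) \<partial>coord_measure))"
    by (subst integral_eq_nn_integral) (auto intro!: measurable_quad)
  also have "\<dots> = r ^ (2 * DIM('a) + dim L) *
      (\<integral>p. indicator (local_config r) (from_coords p) \<partial>coord_measure)"
    using r measurable_indicator_local_config
    by (subst integral_eq_nn_integral) (auto simp: enn2real_mult ennreal_indicator)
  finally show ?thesis
    unfolding rect_cr_eq[abs_def] by (subst poisson_exp_sum_quads[where B = 1]) auto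
qed

end

subsection \<open>The local limit\<close>

lemma nn_integral_iterated_prod6:
  assumes [measurable]: "f1 \<in> borel_measurable M1" "f2 \<in> borel_measurable M2"
    "f3 \<in> borel_measurable M3" "f4 \<in> borel_measurable M4" "f5 \<in> borel_measurable M5"
    "f6 \<in> borel_measurable M6"
  shows "(\<integral>\<^sup>+u. \<integral>\<^sup>+w. \<integral>\<^sup>+x. \<integral>\<^sup>+y. \<integral>\<^sup>+v. \<integral>\<^sup>+z. f1 u * (f2 w * (f3 x * (f4 y * (f5 v * f6 z))))
      \<partial>M6 \<partial>M5 \<partial>M4 \<partial>M3 \<partial>M2 \<partial>M1)
    = integral\<^sup>N M1 f1 * (integral\<^sup>N M2 f2 * (integral\<^sup>N M3 f3 * (integral\<^sup>N M4 f4 *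
      (integral\<^sup>N M5 f5 * integral\<^sup>N M6 f6))))"
  by (simp add: nn_integral_cmult nn_integral_multc)

text \<open>By Cauchy-Schwarz against the basis vectors, every coordinate is at most
  \<open>R\<close> in absolute value, so the ball lies in a cube.\<close>

lemma emeasure_flat_bounded:
  assumes M: "subspace M"
  shows "emeasure (flat_lborel M) {c \<in> space (flat_lborel M). norm (flat_param M 0 c) \<le> R} < \<infinity>"
proof -
  have *: "{c \<in> space (flat_lborel M). norm (flat_param M 0 c) \<le> R}
      \<subseteq> Pi\<^sub>E {..<dim M} (\<lambda>_. {- R..R})"
  proof (rule subsetI)
    fix c assume "c \<in> {c \<in> space (flat_lborel M). norm (flat_param M 0 c) \<le> R}"
    then have c: "c \<in> space (flat_lborel M)" "norm (flat_param M 0 c) \<le> R" by auto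
    have "\<bar>c i\<bar> \<le> R" if "i < dim M" for i
    proof -
      have "norm (onb M i) = 1" using onb_inner[OF M that that] by (simp add: norm_eq_1)
      then show ?thesis
        using Cauchy_Schwarz_ineq2[of "flat_param M 0 c" "onb M i"] c(2)
        by (simp add: flat_param_inner_onb[OF M that])
    qed
    then show "c \<in> Pi\<^sub>E {..<dim M} (\<lambda>_. {- R..R})"
      using c(1) by (auto simp: flat_lborel_def space_PiM PiE_iff abs_le_iff minus_le_iff)
  qed
  have "emeasure (flat_lborel M) (Pi\<^sub>E {..<dim M} (\<lambda>_. {- R..R}))
      = (\<Prod>i<dim M. emeasure lborel {- R..R})"
  proof -
    interpret product_sigma_finite "\<lambda>_::nat. lborel :: real measure" by unfold_locales
    show ?thesis unfolding flat_lborel_def by (subst emeasure_PiM) simp_all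
  qed
  also have "\<dots> < \<infinity>"
    \<comment> \<open>For negative \<open>R\<close> the interval is empty.\<close>
    by (cases "- R \<le> R") (simp_all add: prod_ennreal ennreal_power[symmetric] power_less_top_ennreal)
  finally have "emeasure (flat_lborel M) (Pi\<^sub>E {..<dim M} (\<lambda>_. {- R..R})) < \<infinity>" .
  moreover have "Pi\<^sub>E {..<dim M} (\<lambda>_. {- R..R}) \<in> sets (flat_lborel M)"
    unfolding flat_lborel_def by (intro sets_PiM_I_finite) auto
  ultimately show ?thesis
    using emeasure_mono[OF *] by (meson le_less_trans)
qed

text \<open>Off the frontier, the limit lies in one of the open sets \<open>interior S\<close> and
  \<open>- S\<close>, and \<open>f\<close> eventually enters that set too.\<close>

lemma eventually_mem_iff:
  assumes "(f \<longlongrightarrow> a) F" "closed S" "a \<notin> frontier S"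
  shows "\<forall>\<^sub>F t in F. f t \<in> S \<longleftrightarrow> a \<in> S"
proof (cases "a \<in> S")
  case True
  then have "a \<in> interior S"
    using assms(2,3) by (simp add: frontier_def)
  then have "\<forall>\<^sub>F t in F. f t \<in> interior S"
    by (rule topological_tendstoD[OF assms(1) open_interior])
  then show ?thesis by eventually_elim (use True interior_subset in auto)
next
  case False
  then have "\<forall>\<^sub>F t in F. f t \<in> - S"
    using assms(2) by (intro topological_tendstoD[OF assms(1)]) auto
  then show ?thesis by eventually_elim (use False in auto)
qed

context drawing
begin

lemma W_subset_cball:
  obtains R where "W \<subseteq> cball 0 R"
  using bounded_subset_ballD[OF compact_imp_bounded[OF compact_W], of 0] ball_subset_cball
  by (meson order_trans)

text \<open>The majorant for dominated convergence; its integral is a product of six measures of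
  balls.\<close>

lemma integrable_bounded_config:
  "integrable coord_measure (\<lambda>p. indicator {(u, w, x, y, w', z). norm u \<le> R \<and> norm w \<le> R \<and>
     norm x \<le> 1 \<and> norm y \<le> 2 \<and> norm w' \<le> R \<and> norm z \<le> 1} (from_coords p) :: real)"
    (is "integrable _ (\<lambda>p. indicator ?D (from_coords p))")
proof (rule integrableI_nonneg)
  have "closed ?D" unfolding case_prod_unfold
    by (intro closed_Collect_conj closed_Collect_le continuous_intros)
  then have D: "?D \<in> sets borel" by (rule borel_closed)
  show "(\<lambda>p. indicator ?D (from_coords p) :: real) \<in> borel_measurable coord_measure"
    by (rule measurable_compose[OF measurable_from_coords borel_measurable_indicator[OF D]])
  let ?L = "\<lambda>r. {c \<in> space \<Lambda>. norm (\<phi> c) \<le> r}"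
  let ?M = "\<lambda>r. {c \<in> space \<Lambda>'. norm (\<psi> c) \<le> r}"
  have [measurable]: "?L r \<in> sets \<Lambda>" "?M r \<in> sets \<Lambda>'" for r
    by measurable
  have "(\<integral>\<^sup>+p. ennreal (indicator ?D (from_coords p)) \<partial>coord_measure)
     = (\<integral>\<^sup>+u. \<integral>\<^sup>+w. \<integral>\<^sup>+x. \<integral>\<^sup>+y. \<integral>\<^sup>+w'. \<integral>\<^sup>+z. indicator ?D (\<phi> u, \<psi> w, x, \<phi> y, \<psi> w', z)
         \<partial>lborel \<partial>\<Lambda>' \<partial>\<Lambda> \<partial>lborel \<partial>\<Lambda>' \<partial>\<Lambda>)"
    unfolding ennreal_indicator
    by (rule nn_integral_coord_measure) (rule borel_measurable_indicator[OF D])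
  also have "\<dots> = (\<integral>\<^sup>+u. \<integral>\<^sup>+w. \<integral>\<^sup>+x. \<integral>\<^sup>+y. \<integral>\<^sup>+w'. \<integral>\<^sup>+z.
         indicator (?L R) u * (indicator (?M R) w * (indicator (cball (0::'a) 1) x *
          (indicator (?L 2) y * (indicator (?M R) w' * indicator (cball (0::'a) 1) z))))
         \<partial>lborel \<partial>\<Lambda>' \<partial>\<Lambda> \<partial>lborel \<partial>\<Lambda>' \<partial>\<Lambda>)"
    by (intro nn_integral_cong) (simp add: indicator_def of_bool_conj)
  also have "\<dots> = emeasure \<Lambda> (?L R) * (emeasure \<Lambda>' (?M R) * (emeasure lborel (cball (0::'a) 1) *
          (emeasure \<Lambda> (?L 2) * (emeasure \<Lambda>' (?M R) * emeasure lborel (cball (0::'a) 1)))))"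
    by (subst nn_integral_iterated_prod6) (simp_all add: borel_measurable_indicator)
  also have "\<dots> < \<infinity>"
    using emeasure_flat_bounded[OF L] emeasure_flat_bounded[OF subspace_ocompl[of L]]
      emeasure_compact_finite[OF compact_cball[of "0::'a" 1]]
    by (simp add: ennreal_mult_less_top)
  finally show "(\<integral>\<^sup>+p. ennreal (indicator ?D (from_coords p)) \<partial>coord_measure) < \<infinity>" .
qed simp

text \<open>The bounds are uniform in \<open>r\<close>. Membership in \<open>W\<close> alone would
  only control \<open>r *\<^sub>R y\<close>, so the bound on \<open>y\<close> has to come from the
  crossing; \<open>w'\<close> is bounded as the orthogonal part of a point of \<open>W\<close>,
  whatever \<open>r\<close> is.\<close>

lemma local_config_bounded:
  assumes "W \<subseteq> cball 0 R" and "(u, w, x, y, w', z) \<in> local_config r"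
    and u: "u \<in> L" and w: "w \<in> ocompl L" and y: "y \<in> L" and w': "w' \<in> ocompl L"
  shows "norm u \<le> R \<and> norm w \<le> R \<and> norm x \<le> 1 \<and> norm y \<le> 2 \<and> norm w' \<le> R \<and> norm z \<le> 1"
proof -
  have c: "u + w \<in> W" "u + r *\<^sub>R y + w' \<in> W" "norm x \<le> 1" "norm z \<le> 1" "crossing L x y z"
    using assms(2) by (auto simp: local_config_def)
  have "norm (u + w) \<le> R" "norm (u + r *\<^sub>R y + w') \<le> R"
    using c assms(1) by auto
  moreover have "oproj L (u + w) = u" by (rule oproj_unique[OF L u]) (simp add: w)
  moreover have "oproj L (u + r *\<^sub>R y + w') = u + r *\<^sub>R y"
    by (rule oproj_unique[OF L]) (use L u y w' in \<open>auto intro: subspace_add subspace_scale\<close>)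
  ultimately have "norm u \<le> R" "norm w \<le> R" "norm w' \<le> R"
    using norm_oproj_le[OF L, of "u + w"] norm_diff_oproj_le[OF L, of "u + w"]
      norm_diff_oproj_le[OF L, of "u + r *\<^sub>R y + w'"] by auto
  then show ?thesis using c crossing_norm_le by auto
qed

text \<open>Convexity enters here: the frontier of a convex set is Lebesgue null, and the orthogonal
  decomposition carries this over to the pairs \<open>(u, w)\<close> and
  \<open>(u, w')\<close>.\<close>

lemma AE_not_frontier:
  assumes "convex W"
  shows "AE p in coord_measure. case from_coords p of (u, w, x, y, w', z) \<Rightarrow>
    u + w \<notin> frontier W \<and> u + w' \<notin> frontier W"
proof -
  let ?B1 = "{(u, w, x, y, w', z). u + w \<in> frontier W} :: ('a \<times> 'a \<times> 'a \<times> 'a \<times> 'a \<times> 'a) set"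
  let ?B2 = "{(u, w, x, y, w', z). u + w' \<in> frontier W} :: ('a \<times> 'a \<times> 'a \<times> 'a \<times> 'a \<times> 'a) set"
  have cl: "closed {p. f p \<in> frontier W}" if "continuous_on UNIV f"
    for f :: "('a \<times> 'a \<times> 'a \<times> 'a \<times> 'a \<times> 'a) \<Rightarrow> 'a"
    using closed_vimage[OF frontier_closed that] by (simp add: vimage_def)
  have B: "?B1 \<in> sets borel" "?B2 \<in> sets borel"
    unfolding case_prod_unfold by (intro borel_closed cl continuous_intros)+
  have fr [measurable]: "frontier W \<in> sets borel" by (intro borel_closed frontier_closed)
  have "frontier W \<in> null_sets lebesgue"
    using negligible_convex_frontier[OF assms] by (simp add: negligible_iff_null_sets)
  then have "emeasure lborel (frontier W) = 0"
    using fr by (simp add: null_sets_completion_iff null_setsD1)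
  then have 0: "(\<integral>\<^sup>+u. \<integral>\<^sup>+w. indicator (frontier W) (\<phi> u + \<psi> w) \<partial>\<Lambda>' \<partial>\<Lambda>) = 0"
    using nn_integral_lborel_decomp[OF L, of "indicator (frontier W)"] by simp
  have "(\<integral>\<^sup>+p. indicator ?B1 (from_coords p) \<partial>coord_measure)
     = (\<integral>\<^sup>+u. \<integral>\<^sup>+w. \<integral>\<^sup>+x. \<integral>\<^sup>+y. \<integral>\<^sup>+w'. \<integral>\<^sup>+z. indicator (frontier W) (\<phi> u + \<psi> w)
         \<partial>(lborel :: 'a measure) \<partial>\<Lambda>' \<partial>\<Lambda> \<partial>(lborel :: 'a measure) \<partial>\<Lambda>' \<partial>\<Lambda>)"
    by (subst nn_integral_coord_measure[OF borel_measurable_indicator[OF B(1)]])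
      (intro nn_integral_cong, simp add: indicator_def)
  \<comment> \<open>The unconstrained variables contribute possibly infinite factors, which is
    harmless since \<open>0 * \<infinity> = 0\<close> in \<open>ennreal\<close>.\<close>
  also have "\<dots> = 0" by (simp add: nn_integral_multc 0)
  finally have 1: "AE p in coord_measure. indicator ?B1 (from_coords p) = (0::ennreal)"
    using measurable_compose[OF measurable_from_coords borel_measurable_indicator[OF B(1)]]
    by (subst (asm) nn_integral_0_iff_AE) auto
  have "(\<integral>\<^sup>+p. indicator ?B2 (from_coords p) \<partial>coord_measure)
     = (\<integral>\<^sup>+u. \<integral>\<^sup>+w. \<integral>\<^sup>+x. \<integral>\<^sup>+y. \<integral>\<^sup>+w'. \<integral>\<^sup>+z. indicator (frontier W) (\<phi> u + \<psi> w')
         \<partial>(lborel :: 'a measure) \<partial>\<Lambda>' \<partial>\<Lambda> \<partial>(lborel :: 'a measure) \<partial>\<Lambda>' \<partial>\<Lambda>)"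
    by (subst nn_integral_coord_measure[OF borel_measurable_indicator[OF B(2)]])
      (intro nn_integral_cong, simp add: indicator_def)
  also have "\<dots> = 0" by (simp add: nn_integral_multc 0)
  finally have 2: "AE p in coord_measure. indicator ?B2 (from_coords p) = (0::ennreal)"
    using measurable_compose[OF measurable_from_coords borel_measurable_indicator[OF B(2)]]
    by (subst (asm) nn_integral_0_iff_AE) auto
  show ?thesis
    using 1 2 by eventually_elim (auto simp: indicator_def split: if_splits)
qed

text \<open>\<open>local_config\<close> is defined at \<open>r = 0\<close> as well, where the four
  constraints on \<open>W\<close> collapse to two. Off the frontier the membership tests are
  eventually constant in \<open>t\<close>, so the indicators converge pointwise.\<close>

lemma tendsto_local_config_integral:
  assumes W: "convex W" and \<delta>: "(\<delta> \<longlongrightarrow> 0) at_top"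
  shows "((\<lambda>t::real. \<integral>p. indicat_real (local_config (\<delta> t)) (from_coords p) \<partial>coord_measure) \<longlongrightarrow>
    (\<integral>p. indicator (local_config 0) (from_coords p) \<partial>coord_measure)) at_top"
proof -
  obtain R where R: "W \<subseteq> cball 0 R"
    by (rule W_subset_cball)
  show ?thesis
  proof (rule integral_dominated_convergence_at_top)
    show "integrable coord_measure (\<lambda>p. indicator {(u, w, x, y, w', z). norm u \<le> R \<and> norm w \<le> R \<and>
     norm x \<le> 1 \<and> norm y \<le> 2 \<and> norm w' \<le> R \<and> norm z \<le> 1} (from_coords p) :: real)"
      by (rule integrable_bounded_config)
    show "\<forall>\<^sub>F t in at_top. AE p in coord_measure. norm (indicator (local_config (\<delta> t)) (from_coords p) :: real)
      \<le> indicator {(u, w, x, y, w', z). norm u \<le> R \<and> norm w \<le> R \<and>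
     norm x \<le> 1 \<and> norm y \<le> 2 \<and> norm w' \<le> R \<and> norm z \<le> 1} (from_coords p)"
    proof (intro always_eventually allI AE_I2)
      fix t :: real and p :: "(nat \<Rightarrow> real) \<times> (nat \<Rightarrow> real) \<times> 'a \<times> (nat \<Rightarrow> real) \<times> (nat \<Rightarrow> real) \<times> 'a"
      obtain u w x y w' z where p: "p = (u, w, x, y, w', z)" by (metis prod.exhaust)
      show "norm (indicator (local_config (\<delta> t)) (from_coords p) :: real)
      \<le> indicator {(u, w, x, y, w', z). norm u \<le> R \<and> norm w \<le> R \<and>
     norm x \<le> 1 \<and> norm y \<le> 2 \<and> norm w' \<le> R \<and> norm z \<le> 1} (from_coords p)"
        using local_config_bounded[OF R, of "\<phi> u" "\<psi> w" x "\<phi> y" "\<psi> w'" z "\<delta> t"]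
          flat_param_in[OF L] flat_param_in[OF subspace_ocompl, of L]
        by (simp add: p from_coords_def indicator_def)
    qed
    show "AE p in coord_measure. ((\<lambda>t. indicator (local_config (\<delta> t)) (from_coords p) :: real) \<longlongrightarrow>
        indicator (local_config 0) (from_coords p)) at_top"
      using AE_not_frontier[OF W]
    proof eventually_elim
      fix p assume "case from_coords p of (u, w, x, y, w', z) \<Rightarrow>
        u + w \<notin> frontier W \<and> u + w' \<notin> frontier W"
      moreover obtain u w x y w' z where q: "from_coords p = (u, w, x, y, w', z)"
        by (metis prod.exhaust)
      ultimately have fr: "u + w \<notin> frontier W" "u + w' \<notin> frontier W" by auto
      have "((\<lambda>t. u + w + \<delta> t *\<^sub>R x) \<longlongrightarrow> u + w + 0 *\<^sub>R x) at_top"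
        "((\<lambda>t. u + \<delta> t *\<^sub>R y + w') \<longlongrightarrow> u + 0 *\<^sub>R y + w') at_top"
        "((\<lambda>t. u + \<delta> t *\<^sub>R y + w' + \<delta> t *\<^sub>R z) \<longlongrightarrow> u + 0 *\<^sub>R y + w' + 0 *\<^sub>R z) at_top"
        by (intro tendsto_intros \<delta>)+
      from this[THEN eventually_mem_iff, OF closed_W] fr
      have "\<forall>\<^sub>F t in at_top. u + w + \<delta> t *\<^sub>R x \<in> W \<longleftrightarrow> u + w \<in> W"
        "\<forall>\<^sub>F t in at_top. u + \<delta> t *\<^sub>R y + w' \<in> W \<longleftrightarrow> u + w' \<in> W"
        "\<forall>\<^sub>F t in at_top. u + \<delta> t *\<^sub>R y + w' + \<delta> t *\<^sub>R z \<in> W \<longleftrightarrow> u + w' \<in> W"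
        by auto
      then have "\<forall>\<^sub>F t in at_top. (u, w, x, y, w', z) \<in> local_config (\<delta> t) \<longleftrightarrow>
          (u, w, x, y, w', z) \<in> local_config 0"
        by eventually_elim (auto simp: local_config_def)
      then show "((\<lambda>t. indicator (local_config (\<delta> t)) (from_coords p) :: real) \<longlongrightarrow>
        indicator (local_config 0) (from_coords p)) at_top"
        by (intro tendsto_eventually) (auto elim!: eventually_mono simp: q indicator_def)
    qed
  qed (auto intro: measurable_indicator_local_config)
qed

subsection \<open>Identification of the limit\<close>

text \<open>The integrand of \<open>cd_const\<close> as a closed set; the bound on \<open>y\<close>
  is carried by the crossing condition through \<open>crossing_norm_le\<close>.\<close>

definition cross_ball :: "('a \<times> 'a \<times> 'a) set" where
  "cross_ball = {(x, y, z). norm x \<le> 1 \<and> norm z \<le> 1 \<and> crossing L x y z}"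

lemma closed_cross_ball: "closed cross_ball"
  unfolding cross_ball_def case_prod_unfold
  by (intro closed_Collect_conj closed_Collect_crossing closed_Collect_le continuous_intros)

lemma measurable_cross_ball [measurable]:
  "indicator cross_ball \<in> (borel \<Otimes>\<^sub>M borel \<Otimes>\<^sub>M borel) \<rightarrow>\<^sub>M (borel :: ennreal measure)"
  "indicator cross_ball \<in> (borel \<Otimes>\<^sub>M borel \<Otimes>\<^sub>M borel) \<rightarrow>\<^sub>M (borel :: real measure)"
  using borel_closed[OF closed_cross_ball] by (simp_all add: borel_prod borel_measurable_indicator)

text \<open>The nested Bochner integrals are converted from the inside out. Each inner one must be
  finite for \<open>ennreal\<close> to undo \<open>enn2real\<close>; the unit ball for
  \<open>z\<close> and the disc for \<open>y\<close> ensure this.\<close>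

lemma cd_const_eq:
  "cd_const L = enn2real (\<integral>\<^sup>+x. \<integral>\<^sup>+y. \<integral>\<^sup>+z. indicator cross_ball (x, \<phi> y, z) \<partial>lborel \<partial>\<Lambda> \<partial>lborel)"
proof -
  let ?k = "\<lambda>x y. \<integral>\<^sup>+z. indicator cross_ball (x, y, z) \<partial>(lborel :: 'a measure)"
  have vol: "emeasure lborel (cball (0::'a) 1) < \<infinity>"
    by (rule emeasure_compact_finite[OF compact_cball])
  have k_le: "?k x y \<le> emeasure lborel (cball (0::'a) 1) * indicator (cball 0 2) y" for x y
  proof -
    have "?k x y \<le> (\<integral>\<^sup>+z. indicator (cball 0 2) y * indicator (cball 0 1) z \<partial>(lborel :: 'a measure))"
      by (intro nn_integral_mono)
        (use crossing_norm_le[of x y] in \<open>auto simp: cross_ball_def indicator_def\<close>)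
    then show ?thesis by (subst (asm) nn_integral_cmult_indicator) (simp_all add: mult.commute)
  qed
  have k_fin: "?k x y < \<infinity>" for x y
    by (rule le_less_trans[OF k_le]) (use vol in \<open>simp add: ennreal_mult_less_top indicator_def\<close>)
  have ky_fin: "(\<integral>\<^sup>+y. ?k x (\<phi> y) \<partial>\<Lambda>) < \<infinity>" for x
  proof -
    have S: "{c \<in> space \<Lambda>. norm (\<phi> c) \<le> 2} \<in> sets \<Lambda>" by measurable
    have "(\<integral>\<^sup>+y. ?k x (\<phi> y) \<partial>\<Lambda>) \<le> (\<integral>\<^sup>+y. emeasure lborel (cball (0::'a) 1) *
        indicator {c \<in> space \<Lambda>. norm (\<phi> c) \<le> 2} y \<partial>\<Lambda>)"
      by (intro nn_integral_mono order_trans[OF k_le]) (auto simp: indicator_def)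
    also have "\<dots> < \<infinity>"
      using vol emeasure_flat_bounded[OF L, of 2] S
      by (simp add: nn_integral_cmult ennreal_mult_less_top)
    finally show ?thesis .
  qed
  have z: "indicator (cball 0 1) x * (indicator (cball 0 2) y * (\<integral>z. indicator (cball 0 1) z *
      (if crossing L x y z then 1 else 0) \<partial>lborel)) = enn2real (?k x y)" for x y
  proof -
    have "enn2real (?k x y) = (\<integral>z. indicator cross_ball (x, y, z) \<partial>lborel)"
      by (subst integral_eq_nn_integral) (simp_all add: ennreal_indicator)
    also have "\<dots> = (\<integral>z. indicator (cball 0 1) x * (indicator (cball 0 2) y *
      (indicator (cball 0 1) z * (if crossing L x y z then 1 else 0))) \<partial>lborel)"
      by (intro Bochner_Integration.integral_cong refl)
        (use crossing_norm_le[of x y] in \<open>auto simp: cross_ball_def indicator_def\<close>)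
    finally show ?thesis by simp
  qed
  have "cd_const L = (\<integral>x. \<integral>y. indicator (cball 0 1) x * (indicator (cball 0 2) (\<phi> y) *
      (\<integral>z. indicator (cball 0 1) z * (if crossing L x (\<phi> y) z then 1 else 0) \<partial>lborel)) \<partial>\<Lambda> \<partial>lborel)"
    unfolding cd_const_def sub_integral_def crossing_def by simp
  also have "\<dots> = (\<integral>x. \<integral>y. enn2real (?k x (\<phi> y)) \<partial>\<Lambda> \<partial>lborel)"
    unfolding z ..
  also have "\<dots> = (\<integral>x. enn2real (\<integral>\<^sup>+y. ?k x (\<phi> y) \<partial>\<Lambda>) \<partial>lborel)"
    by (intro Bochner_Integration.integral_cong refl, subst integral_eq_nn_integral)
      (use k_fin in \<open>simp_all add: ennreal_enn2real\<close>)
  also have "\<dots> = enn2real (\<integral>\<^sup>+x. \<integral>\<^sup>+y. ?k x (\<phi> y) \<partial>\<Lambda> \<partial>lborel)"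
    by (subst integral_eq_nn_integral) (use ky_fin in \<open>simp_all add: ennreal_enn2real\<close>)
  finally show ?thesis .
qed

text \<open>\<open>measure\<close> reads 0 on sets of infinite measure, so finiteness of the section
  has to be shown: its points are orthogonal parts of points of the bounded set
  \<open>W\<close>.\<close>

lemma flat_vol_eq:
  "(\<integral>\<^sup>+w. indicator W (\<phi> u + \<psi> w) \<partial>\<Lambda>') = ennreal (flat_vol (ocompl L) (\<phi> u) W)"
proof -
  let ?S = "flat_param (ocompl L) (\<phi> u) -` W \<inter> space \<Lambda>'"
  obtain R where R: "W \<subseteq> cball 0 R"
    by (rule W_subset_cball)
  have [measurable]: "?S \<in> sets \<Lambda>'" by measurable
  have "norm (\<psi> w) \<le> R" if "w \<in> ?S" for w
  proof -
    have "oproj L (\<phi> u + \<psi> w) = \<phi> u"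
      by (rule oproj_unique[OF L flat_param_in[OF L]]) (simp add: flat_param_in)
    moreover have "norm (\<phi> u + \<psi> w) \<le> R"
      using that R flat_param_shift[of "ocompl L" "\<phi> u" w] by auto
    ultimately show ?thesis using norm_diff_oproj_le[OF L, of "\<phi> u + \<psi> w"] by simp
  qed
  then have "?S \<subseteq> {c \<in> space \<Lambda>'. norm (\<psi> c) \<le> R}" by auto
  moreover have "{c \<in> space \<Lambda>'. norm (\<psi> c) \<le> R} \<in> sets \<Lambda>'" by measurable
  ultimately have "emeasure \<Lambda>' ?S < \<infinity>"
    using emeasure_mono emeasure_flat_bounded[OF subspace_ocompl, of L R] by (meson le_less_trans)
  then have "emeasure \<Lambda>' ?S = ennreal (flat_vol (ocompl L) (\<phi> u) W)"
    unfolding flat_vol_def by (intro emeasure_eq_ennreal_measure) simp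
  moreover have "(\<integral>\<^sup>+w. indicator W (\<phi> u + \<psi> w) \<partial>\<Lambda>') = (\<integral>\<^sup>+w. indicator ?S w \<partial>\<Lambda>')"
    by (intro nn_integral_cong) (auto simp: indicator_def flat_param_shift[of "ocompl L" "\<phi> u"])
  ultimately show ?thesis by simp
qed

text \<open>The section over a point outside the projection of \<open>W\<close> is empty, so the
  indicator is absorbed by the squared volume.\<close>

lemma Ik_eq:
  "Ik 2 W L = enn2real (\<integral>\<^sup>+u. (\<integral>\<^sup>+w. indicator W (\<phi> u + \<psi> w) \<partial>\<Lambda>')\<^sup>2 \<partial>\<Lambda>)"
proof -
  let ?v = "\<lambda>u. flat_vol (ocompl L) (\<phi> u) W"
  have v0: "0 \<le> ?v u" for u by (simp add: flat_vol_def)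
  \<comment> \<open>Measurability of the section volume in \<open>u\<close> is inherited from the
    parametrised integral.\<close>
  have "(\<lambda>u. enn2real (\<integral>\<^sup>+w. indicator W (\<phi> u + \<psi> w) \<partial>\<Lambda>')) \<in> borel_measurable \<Lambda>"
    by measurable
  then have [measurable]: "?v \<in> borel_measurable \<Lambda>"
    by (simp add: flat_vol_eq v0)
  have v: "indicator (oproj L ` W) (\<phi> u) * ?v u ^ 2 = ?v u ^ 2" for u
  proof (cases "\<phi> u \<in> oproj L ` W")
    case False
    have "flat_param (ocompl L) (\<phi> u) -` W = {}"
    proof -
      have "oproj L (flat_param (ocompl L) (\<phi> u) w) = \<phi> u" for w
        unfolding flat_param_shift[of "ocompl L" "\<phi> u"]
        by (rule oproj_unique[OF L flat_param_in[OF L]]) (simp add: flat_param_in)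
      then show ?thesis using False by (metis (no_types, lifting) equals0I image_eqI vimage_eq)
    qed
    then show ?thesis by (simp add: flat_vol_def)
  qed simp
  have "Ik 2 W L = (\<integral>u. ?v u ^ 2 \<partial>\<Lambda>)"
    unfolding Ik_def sub_integral_def v ..
  also have "\<dots> = enn2real (\<integral>\<^sup>+u. ennreal (?v u ^ 2) \<partial>\<Lambda>)"
    by (rule integral_eq_nn_integral) simp_all
  finally show ?thesis by (simp add: flat_vol_eq ennreal_power v0)
qed

lemma local_config_limit:
  "(\<integral>p. indicator (local_config 0) (from_coords p) \<partial>coord_measure) = cd_const L * Ik 2 W L"
proof -
  let ?A = "\<lambda>u. \<integral>\<^sup>+w. indicator W (\<phi> u + \<psi> w) \<partial>\<Lambda>'"
  let ?K = "\<integral>\<^sup>+x. \<integral>\<^sup>+y. \<integral>\<^sup>+z. indicator cross_ball (x, \<phi> y, z) \<partial>lborel \<partial>\<Lambda> \<partial>lborel"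
  have "(\<integral>p. indicator (local_config 0) (from_coords p) \<partial>coord_measure)
      = enn2real (\<integral>\<^sup>+p. indicator (local_config 0) (from_coords p) \<partial>coord_measure)"
    using measurable_indicator_local_config
    by (subst integral_eq_nn_integral) (auto simp: ennreal_indicator)
  also have "(\<integral>\<^sup>+p. indicator (local_config 0) (from_coords p) \<partial>coord_measure)
      = (\<integral>\<^sup>+u. \<integral>\<^sup>+w. \<integral>\<^sup>+x. \<integral>\<^sup>+y. \<integral>\<^sup>+w'. \<integral>\<^sup>+z. indicator W (\<phi> u + \<psi> w) *
          (indicator W (\<phi> u + \<psi> w') * indicator cross_ball (x, \<phi> y, z))
         \<partial>lborel \<partial>\<Lambda>' \<partial>\<Lambda> \<partial>lborel \<partial>\<Lambda>' \<partial>\<Lambda>)"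
    by (subst nn_integral_coord_measure[OF borel_measurable_indicator[OF borel_local_config]])
      (intro nn_integral_cong, auto simp: local_config_def cross_ball_def indicator_def)
  \<comment> \<open>At \<open>r = 0\<close> both edges sit over the same \<open>u\<close>, so
    \<open>w\<close> and \<open>w'\<close> each contribute the volume of the same section.\<close>
  also have "\<dots> = (\<integral>\<^sup>+u. (?A u)\<^sup>2 * ?K \<partial>\<Lambda>)"
    by (simp add: nn_integral_cmult nn_integral_multc power2_eq_square mult.assoc)
  also have "\<dots> = (\<integral>\<^sup>+u. (?A u)\<^sup>2 \<partial>\<Lambda>) * ?K"
    by (rule nn_integral_multc) measurable
  finally show ?thesis
    by (simp add: cd_const_eq Ik_eq enn2real_mult mult.commute)
qed

end

theorem theorem1:
  fixes W :: "'a::euclidean_space set" and L :: "'a set" and \<delta> :: "real \<Rightarrow> real"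
  assumes "DIM('a) \<ge> 2"
    and "compact W" and "convex W" and "measure lborel W = 1"
    and "subspace L" and "dim L = 2"
    and "\<And>t. t > 0 \<Longrightarrow> \<delta> t > 0"
    and "(\<delta> \<longlongrightarrow> 0) at_top"
  shows "(\<lambda>t. poisson_exp t W (rect_cr L (\<delta> t))
              - 1/8 * cd_const L * t ^ 4 * \<delta> t ^ (2 * DIM('a) + 2) * Ik 2 W L)
         \<in> o[at_top](\<lambda>t. t ^ 4 * \<delta> t ^ (2 * DIM('a) + 2))"
proof (rule smalloI_tendsto)
  interpret drawing W L
    using assms by unfold_locales
  define J :: "real \<Rightarrow> real"
    where "J r = (\<integral>p. indicator (local_config r) (from_coords p) \<partial>coord_measure)" for r
  have "((\<lambda>t. 1/8 * (J (\<delta> t) - cd_const L * Ik 2 W L)) \<longlongrightarrow> 1/8 * (J 0 - cd_const L * Ik 2 W L)) at_top"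
    unfolding J_def by (intro tendsto_intros tendsto_local_config_integral assms)
  then have lim: "((\<lambda>t. 1/8 * (J (\<delta> t) - cd_const L * Ik 2 W L)) \<longlongrightarrow> 0) at_top"
    by (simp add: J_def local_config_limit)
  have nz: "t ^ 4 * \<delta> t ^ (2 * DIM('a) + 2) \<noteq> 0" if "t > 0" for t
    using that assms(7)[OF that] by simp
  show "\<forall>\<^sub>F t in at_top. t ^ 4 * \<delta> t ^ (2 * DIM('a) + 2) \<noteq> 0"
    using eventually_gt_at_top[of 0] by eventually_elim (rule nz)
  have "\<forall>\<^sub>F t in at_top. 1/8 * (J (\<delta> t) - cd_const L * Ik 2 W L)
      = (poisson_exp t W (rect_cr L (\<delta> t))
          - 1/8 * cd_const L * t ^ 4 * \<delta> t ^ (2 * DIM('a) + 2) * Ik 2 W L)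
        / (t ^ 4 * \<delta> t ^ (2 * DIM('a) + 2))"
    using eventually_gt_at_top[of 0]
  proof eventually_elim
    case (elim t)
    have "poisson_exp t W (rect_cr L (\<delta> t))
          - 1/8 * cd_const L * t ^ 4 * \<delta> t ^ (2 * DIM('a) + 2) * Ik 2 W L
        = 1/8 * (J (\<delta> t) - cd_const L * Ik 2 W L) * (t ^ 4 * \<delta> t ^ (2 * DIM('a) + 2))"
      \<comment> \<open>\<open>assms(6)\<close> replaces \<open>dim L\<close> by 2 in the exponent,
        which makes the normalised error exactly the quantity treated in \<open>lim\<close>.\<close>
      unfolding poisson_exp_rect_cr[OF assms(7)[OF elim]] J_def[symmetric] assms(6)
      by (simp add: algebra_simps)
    then show ?case using nz[OF elim] by simp
  qed
  from Lim_transform_eventually[OF lim this]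
  show "((\<lambda>t. (poisson_exp t W (rect_cr L (\<delta> t))
          - 1/8 * cd_const L * t ^ 4 * \<delta> t ^ (2 * DIM('a) + 2) * Ik 2 W L)
        / (t ^ 4 * \<delta> t ^ (2 * DIM('a) + 2))) \<longlongrightarrow> 0) at_top" .
qed

end
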